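(* Let $(\mathcal{B},\mathcal{L},\theta,\mathcal{I}_\alpha)$ be a generalized Boolean dynamical system, let $\partial E$ be its boundary path space with shift map $\sigma_E$, let $\mathbb{F}$ be the free group generated by $\mathcal{L}$, and let $\varphi$ be the associated partial action of $\mathbb{F}$ on $\partial E$. The map $\Theta:\mathbb{F}\ltimes_\varphi\partial E\to\Gamma(\partial E,\sigma_E)$ defined by $$\Theta((\mu,\alpha\beta^{-1},\nu))=(\mu,|\alpha|-|\beta|,\nu)$$ (where every element of $\mathbb{F}\ltimes_\varphi\partial E$ has middle coordinate of the form $\alpha\beta^{-1}$ with $\alpha,\beta\in\mathcal{W}^*$) is an isomorphism of topological groupoids.
   Context: Boolean algebras. A Boolean algebra is a set $\mathcal{B}$ with an element $\emptyset$ and operations $\cap,\cup,\setminus$ such that $(\mathcal{B},\cap,\cup)$ is a distributive lattice, $A\cap\emptyset=\emptyset$, $(A\cap B)\cup(A\setminus B)=A$ and $(A\cap B)\cap(A\setminus B)=\emptyset$ (no unit is required). $A\subseteq B$ means $A\cap B=A$. An ideal is a non-empty subset closed under $\cup$ and under intersection with arbitrary elements of $\mathcal{B}$; it is itself a Boolean algebra. A filter is a non-empty subset not containing $\emptyset$, upward closed and closed under $\cap$; an ultrafilter is a maximal filter. An action on $\mathcal{B}$ is a map $\mathcal{B}\to\mathcal{B}$ preserving $\cap,\cup,\setminus$ and $\emptyset$. Generalized Boolean dynamical system. A quadruple $(\mathcal{B},\mathcal{L},\theta,\mathcal{I}_\alpha)$ with $\mathcal{B}$ a Boolean algebra, $\mathcal{L}$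 a set, $\{\theta_\alpha\}_{\alpha\in\mathcal{L}}$ actions on $\mathcal{B}$, and $\{\mathcal{I}_\alpha\}_{\alpha\in\mathcal{L}}$ ideals of $\mathcal{B}$ with $\mathcal{R}_\alpha:=\{A\in\mathcal{B}:A\subseteq\theta_\alpha(B)\text{ for some }B\in\mathcal{B}\}\subseteq\mathcal{I}_\alpha$. $\mathcal{L}^*$ is the set of finite words in $\mathcal{L}$, including the empty word $\emptyset$; $|\alpha|$ is length. For $\alpha=\alpha_1\cdots\alpha_n$, $n\ge1$: $\theta_\alpha=\theta_{\alpha_n}\circ\cdots\circ\theta_{\alpha_1}$, $\theta_\emptyset=\mathrm{id}$, $\mathcal{I}_\alpha=\{A\in\mathcal{B}:A\subseteq\theta_{\alpha_2\cdots\alpha_n}(B)\text{ for some }B\in\mathcal{I}_{\alpha_1}\}$, $\mathcal{I}_\emptyset=\mathcal{B}$. $\mathcal{W}^*=\{\alpha\in\mathcal{L}^*:\mathcal{I}_\alpha\ne\{\emptyset\}\}$ and $\mathcal{W}^{\ge1}$ is the set of words of length $\ge1$ in $\mathcal{W}^*$. $X_\alpha$ is the set of ultrafilters in $\mathcal{I}_\alpha$ with the topology generated by the sets $\{\mathcal{F}\in X_\alpha:A\in\mathcal{F}\}$, $A\in\mathcal{I}_\alpha$. Boundary path space. $E^0=X_\emptyset$; $F^0=X_\emptyset\cup\{\emptyset\}$, where $\emptyset$ is an isolated point if $\mathcal{B}$ is unital and the point at infinity of the one-point compactification of $X_\emptyset$ otherwise. $E^1=\{e^\alpha_\eta:\alpha\in\mathcal{L},\eta\in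 X_\alpha\}$ with the topology of the disjoint union of the $X_\alpha$. For $\alpha\in\mathcal{L}$ put $f_{\emptyset[\alpha]}(\eta)=\{A\in\mathcal{B}:\theta_\alpha(A)\in\eta\}$ (an ultrafilter of $\mathcal{B}$ or $\emptyset$). Define $d:E^1\to E^0$, $d(e^\alpha_\eta)=\{B\in\mathcal{B}:A\subseteq B\text{ for some }A\in\eta\}$ and $r:E^1\to F^0$, $r(e^\alpha_\eta)=f_{\emptyset[\alpha]}(\eta)$. For $n\ge 2$, $E^n$ is the subspace of $\prod_{i=1}^nE^1$ of $(e_1,\dots,e_n)$ with $d(e_i)=r(e_{i+1})$; $E^*=\bigsqcup_{n\ge0}E^n$; $E^\infty$ is the set of infinite sequences in $E^1$ with $d(e_i)=r(e_{i+1})$ for all $i$. For a path, $r$ is $r$ of its first edge, $d$ of a finite path is $d$ of its last edge; $r(v)=d(v)=v$ for $v\in E^0$. Put $F^0_{sce}=F^0\setminus\overline{r(E^1)}$, $F^0_{fin}=\{v\in F^0: v\text{ has a neighborhood }V\text{ with }r^{-1}(V)\text{ compact}\}$, $F^0_{rg}=F^0_{fin}\setminus\overline{F^0_{sce}}$, $E^0_{sg}=E^0\setminus F^0_{rg}$. Then $\partial E=E^\infty\sqcup\{\mu\in E^*:d(\mu)\in E^0_{sg}\}$. For $S\subseteq E^*$ let $\mathcal{Z}(S)$ be the set of $\mu\in\partial E$ with $r(\mu)\in S$ or $\mu_1\cdots\mu_i\in S$ for some $1\le i\le|\mu|$; the topology of $\partial E$ is generated by the sets $\mathcal{Z}(U)\cap\mathcal{Z}(K)^c$,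 $U\subseteq E^*$ open, $K\subseteq E^*$ compact. The shift $\sigma=\sigma_E:\partial E\setminus E^0_{sg}\to\partial E$ removes the first edge of paths of length $\ge2$, and $\sigma_E(\mu)=d(\mu)$ for $|\mu|=1$; it is a local homeomorphism. The partial action. Words are regarded as elements of $\mathbb{F}$, with $\emptyset$ the identity. $U_\emptyset=\partial E$. For $\alpha,\beta\in\mathcal{W}^{\ge1}$ with $\alpha\beta^{-1}$ in reduced form, $U_{\alpha\beta^{-1}}$ is the set of $(e^{\gamma_k}_{\eta_k})_{k=1}^N\in\partial E$ with $\gamma_1\cdots\gamma_{|\alpha|}=\alpha$ and $\eta_{|\alpha|}\cap\mathcal{I}_\beta\ne\emptyset$. For $\alpha\in\mathcal{W}^{\ge1}$, $U_\alpha=\{(e^{\gamma_k}_{\eta_k})_{k=1}^N\in\partial E:\gamma_1\cdots\gamma_{|\alpha|}=\alpha\}$. For $\beta\in\mathcal{W}^{\ge1}$, $U_{\beta^{-1}}=\{\mu\in\partial E:r(\mu)\cap\mathcal{I}_\beta\ne\emptyset\}$. For all other $t\in\mathbb{F}$, $U_t=\emptyset$. The homeomorphisms $\varphi_t:U_{t^{-1}}\to U_t$ are: $\varphi_\emptyset=\mathrm{id}$; for $\beta\in\mathcal{W}^{\ge1}$, $\varphi_{\beta^{-1}}$ removes the first $|\beta|$ edges (if $|\mu|=|\beta|$ the result is $d(\mu)\in E^0$); for $\alpha=\alpha_1\cdots\alpha_n\in\mathcal{W}^{\ge1}$ and $\beta\in\mathcal{W}^*$ with $\alpha\beta^{-1}$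 reduced and $U_{\beta\alpha^{-1}}\neq\emptyset$, $\varphi_{\alpha\beta^{-1}}(\mu)$ is obtained by removing the first $|\beta|$ edges of $\mu$ and adding at the beginning $e^{\alpha_1}_{\eta_1}\cdots e^{\alpha_n}_{\eta_n}$, where $\eta_n=\zeta\cap\mathcal{I}_{\alpha_n}$ with $\zeta=d(\mu_{|\beta|})$ if $\beta\ne\emptyset$ and $\zeta=r(\mu)$ if $\beta=\emptyset$, and $\eta_i=f_{\emptyset[\alpha_{i+1}]}(\eta_{i+1})\cap\mathcal{I}_{\alpha_i}$ for $i=n-1,\dots,1$; all other $\varphi_t$ are empty maps. This is a partial action of $\mathbb{F}$ on $\partial E$. Groupoids. $\mathbb{F}\ltimes_\varphi\partial E=\{(\mu,t,\nu)\in\partial E\times\mathbb{F}\times\partial E:\nu\in U_{t^{-1}},\ \mu=\varphi_t(\nu)\}$ with product $(\mu,t,\nu)(\nu,s,\delta)=(\mu,ts,\delta)$, inverse $(\mu,t,\nu)^{-1}=(\nu,t^{-1},\mu)$ and the topology inherited from the product topology ($\mathbb{F}$ discrete). $\Gamma(\partial E,\sigma_E)=\{(\mu,k-l,\nu)\in\partial E\times\mathbb{Z}\times\partial E:\mu\in\mathrm{dom}(\sigma^k),\nu\in\mathrm{dom}(\sigma^l),\sigma^k(\mu)=\sigma^l(\nu)\}$ with product $(\mu,n,\nu)(\nu,m,\delta)=(\mu,n+m,\delta)$, inverse $(\nu,-n,\mu)$, and topology generated by the sets $\{(\mu,k_1-k_2,\nu):\mu\in U,\nu\in V,\sigma^{k_1}(\mu)=\sigma^{k_2}(\nu)\}$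 where $U\subseteq\mathrm{dom}(\sigma^{k_1})$ and $V\subseteq\mathrm{dom}(\sigma^{k_2})$ are open in $\partial E$, $\sigma^{k_1}$ is injective on $U$ and $\sigma^{k_2}$ is injective on $V$. *)

theory Defs
  imports "HOL-Analysis.Analysis" "HOL-Algebra.Group"
begin

section \<open>Boolean algebras without unit\<close>

text \<open>Possibly non-unital Boolean algebras: the empty element is \<open>bot\<close>, and intersection, union and
  difference are \<open>inf\<close>, \<open>sup\<close> and \<open>-\<close>. (The library class \<open>boolean_algebra\<close> requires a unit.)\<close>

class generalized_boolean_algebra = distrib_lattice + bounded_lattice_bot + minus +
  assumes sup_inf_diff: "sup (inf x y) (x - y) = x"
    and inf_inf_diff: "inf (inf x y) (x - y) = bot"

definition unital :: "'b::generalized_boolean_algebra itself \<Rightarrow> bool" where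
  "unital _ \<longleftrightarrow> (\<exists>u::'b. \<forall>A. A \<le> u)"

definition ba_ideal :: "'b::generalized_boolean_algebra set \<Rightarrow> bool" where
  "ba_ideal J \<longleftrightarrow> J \<noteq> {} \<and> (\<forall>A\<in>J. \<forall>B\<in>J. sup A B \<in> J) \<and> (\<forall>A\<in>J. \<forall>B. inf A B \<in> J)"

definition filter_in :: "'b::generalized_boolean_algebra set \<Rightarrow> 'b set \<Rightarrow> bool" where
  "filter_in J \<F> \<longleftrightarrow> \<F> \<subseteq> J \<and> \<F> \<noteq> {} \<and> bot \<notin> \<F>
     \<and> (\<forall>A\<in>\<F>. \<forall>B\<in>J. A \<le> B \<longrightarrow> B \<in> \<F>)
     \<and> (\<forall>A\<in>\<F>. \<forall>B\<in>\<F>. inf A B \<in> \<F>)"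

definition ultrafilters_in :: "'b::generalized_boolean_algebra set \<Rightarrow> 'b set set" where
  "ultrafilters_in J = {\<F>. filter_in J \<F> \<and> (\<forall>\<G>. filter_in J \<G> \<longrightarrow> \<F> \<subseteq> \<G> \<longrightarrow> \<G> = \<F>)}"

definition ultrafilter_topology :: "'b::generalized_boolean_algebra set \<Rightarrow> 'b set topology" where
  "ultrafilter_topology J = topology_generated_by {{\<F> \<in> ultrafilters_in J. A \<in> \<F>} | A. A \<in> J}"

definition ba_action :: "('b::generalized_boolean_algebra \<Rightarrow> 'b) \<Rightarrow> bool" where
  "ba_action f \<longleftrightarrow> f bot = bot \<and> (\<forall>A B. f (inf A B) = inf (f A) (f B)
     \<and> f (sup A B) = sup (f A) (f B) \<and> f (A - B) = f A - f B)"


section \<open>Generalized Boolean dynamical systems\<close>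

text \<open>The Boolean algebra is the type \<open>'b\<close>. The label set is a subset of a type, since it may be
  empty; the fields \<open>act\<close> and \<open>ideal\<close> only matter on it.\<close>

record ('l, 'b) gbds =
  labels :: "'l set"
  act :: "'l \<Rightarrow> 'b \<Rightarrow> 'b"
  ideal :: "'l \<Rightarrow> 'b set"

definition act_range :: "('l, 'b::generalized_boolean_algebra) gbds \<Rightarrow> 'l \<Rightarrow> 'b set" where
  "act_range S a = {A. \<exists>B. A \<le> act S a B}"

definition generalized_boolean_dynamical_system ::
    "('l, 'b::generalized_boolean_algebra) gbds \<Rightarrow> bool" where
  "generalized_boolean_dynamical_system S \<longleftrightarrow>
     (\<forall>a\<in>labels S. ba_action (act S a) \<and> ba_ideal (ideal S a) \<and> act_range S a \<subseteq> ideal S a)"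

text \<open>\<open>fold\<close> applies the action of the first letter first.\<close>

definition act_word :: "('l, 'b) gbds \<Rightarrow> 'l list \<Rightarrow> 'b \<Rightarrow> 'b" where
  "act_word S w = fold (act S) w"

fun ideal_word :: "('l, 'b::generalized_boolean_algebra) gbds \<Rightarrow> 'l list \<Rightarrow> 'b set" where
  "ideal_word S [] = UNIV"
| "ideal_word S (a # w) = {A. \<exists>B \<in> ideal S a. A \<le> act_word S w B}"

definition Wstar :: "('l, 'b::generalized_boolean_algebra) gbds \<Rightarrow> 'l list set" where
  "Wstar S = {w \<in> lists (labels S). ideal_word S w \<noteq> {bot}}"

definition Wpos :: "('l, 'b::generalized_boolean_algebra) gbds \<Rightarrow> 'l list set" where
  "Wpos S = {w \<in> Wstar S. length w \<ge> 1}"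


section \<open>The topological correspondence\<close>

definition E0 :: "('l, 'b::generalized_boolean_algebra) gbds \<Rightarrow> 'b set set" where
  "E0 S = ultrafilters_in UNIV"

definition E0_top :: "('l, 'b::generalized_boolean_algebra) gbds \<Rightarrow> 'b set topology" where
  "E0_top S = ultrafilter_topology UNIV"

text \<open>The additional point of \<open>F0\<close> is the empty set \<open>{}\<close>, which is not an ultrafilter.\<close>

definition F0 :: "('l, 'b::generalized_boolean_algebra) gbds \<Rightarrow> 'b set set" where
  "F0 S = insert {} (E0 S)"

definition F0_top :: "('l, 'b::generalized_boolean_algebra) gbds \<Rightarrow> 'b set topology" where
  "F0_top S =
     (if unital TYPE('b)
      then topology (\<lambda>V. V \<subseteq> F0 S \<and> openin (E0_top S) (V - {{}}))
      else pullback_topology (F0 S) (\<lambda>v. if v = {} then None else Some v)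
             (Alexandroff_compactification (E0_top S)))"

lemma openin_F0_top_unital:
  assumes "unital TYPE('b)"
  shows "openin (F0_top (S :: ('l, 'b::generalized_boolean_algebra) gbds)) V
    \<longleftrightarrow> V \<subseteq> F0 S \<and> openin (E0_top S) (V - {{}})"
proof -
  have "istopology (\<lambda>V. V \<subseteq> F0 S \<and> openin (E0_top S) (V - {{}}))"
    unfolding istopology_def
  proof (intro conjI allI impI)
    fix V W assume "V \<subseteq> F0 S \<and> openin (E0_top S) (V - {{}})" "W \<subseteq> F0 S \<and> openin (E0_top S) (W - {{}})"
    then have "V \<inter> W \<subseteq> F0 S" "openin (E0_top S) ((V - {{}}) \<inter> (W - {{}}))" by (auto intro: openin_Int)
    moreover have "(V - {{}}) \<inter> (W - {{}}) = V \<inter> W - {{}}" by blast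
    ultimately show "V \<inter> W \<subseteq> F0 S" "openin (E0_top S) (V \<inter> W - {{}})" by simp_all
  next
    fix \<V> assume "\<forall>V\<in>\<V>. V \<subseteq> F0 S \<and> openin (E0_top S) (V - {{}})"
    then have "\<Union>\<V> \<subseteq> F0 S" and open_Un: "openin (E0_top S) (\<Union>V\<in>\<V>. V - {{}})"
      by (blast, blast intro: openin_Union)
    have eq: "\<Union>\<V> - {{}} = (\<Union>V\<in>\<V>. V - {{}})" by blast
    show "\<Union>\<V> \<subseteq> F0 S" by fact
    show "openin (E0_top S) (\<Union>\<V> - {{}})" unfolding eq by (rule open_Un)
  qed
  then show ?thesis using assms by (simp add: F0_top_def)
qed

text \<open>The edge with label \<open>a\<close> and ultrafilter \<open>\<eta>\<close> is the pair \<open>(a, \<eta>)\<close>.\<close>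

definition E1 :: "('l, 'b::generalized_boolean_algebra) gbds \<Rightarrow> ('l \<times> 'b set) set" where
  "E1 S = (SIGMA a:labels S. ultrafilters_in (ideal S a))"

definition E1_top :: "('l, 'b::generalized_boolean_algebra) gbds \<Rightarrow> ('l \<times> 'b set) topology" where
  "E1_top S = sum_topology (\<lambda>a. ultrafilter_topology (ideal S a)) (labels S)"

definition pull_filter :: "('l, 'b) gbds \<Rightarrow> 'l \<Rightarrow> 'b set \<Rightarrow> 'b set" where
  "pull_filter S a \<eta> = {A. act S a A \<in> \<eta>}"

definition dom_edge :: "'l \<times> 'b::generalized_boolean_algebra set \<Rightarrow> 'b set" where
  "dom_edge e = {B. \<exists>A \<in> snd e. A \<le> B}"

definition rng_edge :: "('l, 'b) gbds \<Rightarrow> 'l \<times> 'b set \<Rightarrow> 'b set" where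
  "rng_edge S e = pull_filter S (fst e) (snd e)"

definition F0_sce :: "('l, 'b::generalized_boolean_algebra) gbds \<Rightarrow> 'b set set" where
  "F0_sce S = F0 S - (F0_top S) closure_of (rng_edge S ` E1 S)"

definition F0_fin :: "('l, 'b::generalized_boolean_algebra) gbds \<Rightarrow> 'b set set" where
  "F0_fin S = {v \<in> F0 S. \<exists>U V. openin (F0_top S) U \<and> v \<in> U \<and> U \<subseteq> V \<and> V \<subseteq> F0 S
     \<and> compactin (E1_top S) {e \<in> E1 S. rng_edge S e \<in> V}}"

definition F0_rg :: "('l, 'b::generalized_boolean_algebra) gbds \<Rightarrow> 'b set set" where
  "F0_rg S = F0_fin S - (F0_top S) closure_of (F0_sce S)"

definition E0_sg :: "('l, 'b::generalized_boolean_algebra) gbds \<Rightarrow> 'b set set" where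
  "E0_sg S = E0 S - F0_rg S"


section \<open>Paths and the boundary path space\<close>

text \<open>Paths of length 0 are vertices; lists in \<open>Finite_Path\<close> are meant to be non-empty. Edges are
  numbered from 0.\<close>

datatype ('e, 'v) path = Vertex 'v | Finite_Path "'e list" | Infinite_Path "nat \<Rightarrow> 'e"

type_synonym ('l, 'b) bpath = "('l \<times> 'b set, 'b set) path"

fun path_length :: "('e, 'v) path \<Rightarrow> enat" where
  "path_length (Vertex v) = 0"
| "path_length (Finite_Path p) = enat (length p)"
| "path_length (Infinite_Path f) = \<infinity>"

fun edge :: "('e, 'v) path \<Rightarrow> nat \<Rightarrow> 'e" where
  "edge (Vertex v) i = undefined"
| "edge (Finite_Path p) i = p ! i"
| "edge (Infinite_Path f) i = f i"

definition initial_path :: "nat \<Rightarrow> ('e, 'v) path \<Rightarrow> ('e, 'v) path" where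
  "initial_path i \<mu> = Finite_Path (map (edge \<mu>) [0..<i])"

fun path_rng :: "('l, 'b) gbds \<Rightarrow> ('l, 'b) bpath \<Rightarrow> 'b set" where
  "path_rng S (Vertex v) = v"
| "path_rng S (Finite_Path p) = rng_edge S (hd p)"
| "path_rng S (Infinite_Path f) = rng_edge S (f 0)"

fun path_dom :: "('l, 'b::generalized_boolean_algebra) bpath \<Rightarrow> 'b set" where
  "path_dom (Vertex v) = v"
| "path_dom (Finite_Path p) = dom_edge (last p)"
| "path_dom (Infinite_Path f) = undefined"

definition E_n :: "('l, 'b::generalized_boolean_algebra) gbds \<Rightarrow> nat \<Rightarrow> ('l, 'b) bpath set" where
  "E_n S n = (if n = 0 then Vertex ` E0 S
     else Finite_Path ` {p. length p = n \<and> set p \<subseteq> E1 S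
       \<and> (\<forall>i. Suc i < n \<longrightarrow> dom_edge (p ! i) = rng_edge S (p ! Suc i))})"

text \<open>For \<open>n \<ge> 1\<close> this is the subspace topology of the \<open>n\<close>-fold product of \<open>E1\<close>, lists being
  identified with functions on \<open>{..<n}\<close>.\<close>

definition E_n_top :: "('l, 'b::generalized_boolean_algebra) gbds \<Rightarrow> nat \<Rightarrow> ('l, 'b) bpath topology" where
  "E_n_top S n = (if n = 0 then pullback_topology (E_n S 0) path_dom (E0_top S)
     else pullback_topology (E_n S n) (\<lambda>\<mu>. \<lambda>i\<in>{..<n}. edge \<mu> i)
            (product_topology (\<lambda>_. E1_top S) {..<n}))"

definition E_star :: "('l, 'b::generalized_boolean_algebra) gbds \<Rightarrow> ('l, 'b) bpath set" where
  "E_star S = (\<Union>n. E_n S n)"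

definition E_star_top :: "('l, 'b::generalized_boolean_algebra) gbds \<Rightarrow> ('l, 'b) bpath topology" where
  "E_star_top S = topology (\<lambda>U. U \<subseteq> E_star S \<and> (\<forall>n. openin (E_n_top S n) (U \<inter> E_n S n)))"

lemma openin_E_star_top:
  "openin (E_star_top S) U \<longleftrightarrow> U \<subseteq> E_star S \<and> (\<forall>n. openin (E_n_top S n) (U \<inter> E_n S n))"
proof -
  have "istopology (\<lambda>U. U \<subseteq> E_star S \<and> (\<forall>n. openin (E_n_top S n) (U \<inter> E_n S n)))"
    unfolding istopology_def
  proof (intro conjI allI impI)
    fix U V n
    assume "U \<subseteq> E_star S \<and> (\<forall>n. openin (E_n_top S n) (U \<inter> E_n S n))"
      "V \<subseteq> E_star S \<and> (\<forall>n. openin (E_n_top S n) (V \<inter> E_n S n))"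
    then have "U \<inter> V \<subseteq> E_star S" "openin (E_n_top S n) ((U \<inter> E_n S n) \<inter> (V \<inter> E_n S n))"
      by (auto intro: openin_Int)
    moreover have "(U \<inter> E_n S n) \<inter> (V \<inter> E_n S n) = U \<inter> V \<inter> E_n S n" by blast
    ultimately show "U \<inter> V \<subseteq> E_star S" "openin (E_n_top S n) (U \<inter> V \<inter> E_n S n)" by simp_all
  next
    fix \<U> n assume "\<forall>U\<in>\<U>. U \<subseteq> E_star S \<and> (\<forall>n. openin (E_n_top S n) (U \<inter> E_n S n))"
    then have "\<Union>\<U> \<subseteq> E_star S" and open_Un: "openin (E_n_top S n) (\<Union>U\<in>\<U>. U \<inter> E_n S n)"
      by (blast, blast intro: openin_Union)
    have eq: "\<Union>\<U> \<inter> E_n S n = (\<Union>U\<in>\<U>. U \<inter> E_n S n)" by blast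
    show "\<Union>\<U> \<subseteq> E_star S" by fact
    show "openin (E_n_top S n) (\<Union>\<U> \<inter> E_n S n)" unfolding eq by (rule open_Un)
  qed
  then show ?thesis by (simp add: E_star_top_def)
qed

definition E_inf :: "('l, 'b::generalized_boolean_algebra) gbds \<Rightarrow> ('l, 'b) bpath set" where
  "E_inf S = Infinite_Path `
     {f. \<forall>i. f i \<in> E1 S \<and> dom_edge (f i) = rng_edge S (f (Suc i))}"

definition boundary :: "('l, 'b::generalized_boolean_algebra) gbds \<Rightarrow> ('l, 'b) bpath set" where
  "boundary S = E_inf S \<union> {\<mu> \<in> E_star S. path_dom \<mu> \<in> E0_sg S}"

definition cylinder ::
    "('l, 'b::generalized_boolean_algebra) gbds \<Rightarrow> ('l, 'b) bpath set \<Rightarrow> ('l, 'b) bpath set" where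
  "cylinder S X = {\<mu> \<in> boundary S. Vertex (path_rng S \<mu>) \<in> X
     \<or> (\<exists>i\<ge>1. enat i \<le> path_length \<mu> \<and> initial_path i \<mu> \<in> X)}"

definition boundary_top :: "('l, 'b::generalized_boolean_algebra) gbds \<Rightarrow> ('l, 'b) bpath topology" where
  "boundary_top S = topology_generated_by
     {cylinder S U - cylinder S K | U K. openin (E_star_top S) U \<and> compactin (E_star_top S) K}"

text \<open>The shift is a partial map; its value at vertices is a dummy, and its domain and those of its
  powers are \<open>shift_domain S k\<close>.\<close>

fun shift :: "('l, 'b::generalized_boolean_algebra) bpath \<Rightarrow> ('l, 'b) bpath" where
  "shift (Vertex v) = Vertex v"
| "shift (Finite_Path p) =
     (if length p \<ge> 2 then Finite_Path (tl p) else Vertex (path_dom (Finite_Path p)))"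
| "shift (Infinite_Path f) = Infinite_Path (\<lambda>i. f (Suc i))"

fun shift_domain :: "('l, 'b::generalized_boolean_algebra) gbds \<Rightarrow> nat \<Rightarrow> ('l, 'b) bpath set" where
  "shift_domain S 0 = boundary S"
| "shift_domain S (Suc k) = {\<mu> \<in> boundary S - Vertex ` E0_sg S. shift \<mu> \<in> shift_domain S k}"


section \<open>Free groups\<close>

text \<open>Elements are reduced words; the letter \<open>(a, True)\<close> is the generator \<open>a\<close> and \<open>(a, False)\<close> is
  its inverse.\<close>

type_synonym 'l free_word = "('l \<times> bool) list"

definition inv_letter :: "'l \<times> bool \<Rightarrow> 'l \<times> bool" where
  "inv_letter x = (fst x, \<not> snd x)"

definition reduced :: "'l free_word \<Rightarrow> bool" where
  "reduced w \<longleftrightarrow> successively (\<lambda>x y. y \<noteq> inv_letter x) w"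

fun cancel_cons :: "'l \<times> bool \<Rightarrow> 'l free_word \<Rightarrow> 'l free_word" where
  "cancel_cons x [] = [x]"
| "cancel_cons x (y # w) = (if y = inv_letter x then w else x # y # w)"

definition reduce :: "'l free_word \<Rightarrow> 'l free_word" where
  "reduce w = foldr cancel_cons w []"

definition free_group :: "'l set \<Rightarrow> 'l free_word monoid" where
  "free_group L = \<lparr>carrier = {w \<in> lists (L \<times> UNIV). reduced w},
                   mult = (\<lambda>u v. reduce (u @ v)), one = []\<rparr>"

definition inv_word :: "'l free_word \<Rightarrow> 'l free_word" where
  "inv_word w = rev (map inv_letter w)"

lemma inv_letter_inv_letter [simp]: "inv_letter (inv_letter x) = x"
  by (simp add: inv_letter_def)

lemma reduced_Nil [simp]: "reduced []"
  by (simp add: reduced_def)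

lemma reduced_Cons: "reduced (x # w) \<longleftrightarrow> reduced w \<and> (w = [] \<or> hd w \<noteq> inv_letter x)"
  by (cases w) (auto simp: reduced_def)

lemma reduced_cancel_cons: "reduced w \<Longrightarrow> reduced (cancel_cons x w)"
  by (cases w) (auto simp: reduced_Cons)

lemma reduced_foldr: "reduced w \<Longrightarrow> reduced (foldr cancel_cons u w)"
  by (induction u) (auto intro: reduced_cancel_cons)

lemma reduced_reduce: "reduced (reduce w)"
  by (simp add: reduce_def reduced_foldr)

lemma reduce_reduced: "reduced w \<Longrightarrow> reduce w = w"
proof (induction w)
  case (Cons x w)
  then show ?case by (cases w) (auto simp: reduced_Cons reduce_def)
qed (simp add: reduce_def)

lemma cancel_cons_inv: "reduced w \<Longrightarrow> cancel_cons x (cancel_cons (inv_letter x) w) = w"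
  by (cases w rule: list.exhaust; cases "tl w") (auto simp: reduced_Cons)

lemma foldr_cancel_cons:
  assumes "reduced z"
  shows "foldr cancel_cons (cancel_cons x u) z = cancel_cons x (foldr cancel_cons u z)"
proof (cases u)
  case (Cons y v)
  then show ?thesis
    using assms by (auto simp: cancel_cons_inv reduced_foldr)
qed simp

lemma foldr_foldr_cancel_cons:
  assumes "reduced z"
  shows "foldr cancel_cons (foldr cancel_cons u v) z = foldr cancel_cons u (foldr cancel_cons v z)"
  using assms by (induction u) (auto simp: foldr_cancel_cons)

lemma foldr_reduce:
  assumes "reduced z"
  shows "foldr cancel_cons (reduce u) z = foldr cancel_cons u z"
  using assms by (induction u) (auto simp: reduce_def foldr_cancel_cons)

lemma reduce_append: "reduce (u @ v) = foldr cancel_cons u (reduce v)"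
  by (simp add: reduce_def)

lemma set_cancel_cons: "set (cancel_cons x w) \<subseteq> insert x (set w)"
  by (cases w) auto

lemma set_reduce: "set (reduce w) \<subseteq> set w"
proof (induction w)
  case (Cons x w)
  then show ?case using set_cancel_cons[of x "reduce w"] by (auto simp: reduce_def)
qed (simp add: reduce_def)

lemma foldr_inv_word:
  assumes "reduced z"
  shows "foldr cancel_cons (inv_word w) (foldr cancel_cons w z) = z"
  using assms
proof (induction w arbitrary: z)
  case (Cons x w)
  have "cancel_cons (inv_letter x) (cancel_cons x (foldr cancel_cons w z)) = foldr cancel_cons w z"
    using cancel_cons_inv[of "foldr cancel_cons w z" "inv_letter x"] Cons.prems
    by (simp add: reduced_foldr)
  then show ?case using Cons by (simp add: inv_word_def)
qed (simp add: inv_word_def)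

lemma reduce_inv_word: "reduce (inv_word w @ w) = []"
  using foldr_inv_word[of "[]" w] by (simp add: reduce_def)

lemma inv_word_closed: "w \<in> carrier (free_group L) \<Longrightarrow> reduce (inv_word w) \<in> carrier (free_group L)"
  using set_reduce[of "inv_word w"]
  by (fastforce simp: free_group_def reduced_reduce inv_word_def inv_letter_def lists_eq_set)

lemma group_free_group: "group (free_group L)"
proof (rule groupI)
  fix u v assume "u \<in> carrier (free_group L)" "v \<in> carrier (free_group L)"
  then show "u \<otimes>\<^bsub>free_group L\<^esub> v \<in> carrier (free_group L)"
    using set_reduce[of "u @ v"] by (auto simp: free_group_def reduced_reduce lists_eq_set)
next
  fix u v w :: "'a free_word"
  show "u \<otimes>\<^bsub>free_group L\<^esub> v \<otimes>\<^bsub>free_group L\<^esub> w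
      = u \<otimes>\<^bsub>free_group L\<^esub> (v \<otimes>\<^bsub>free_group L\<^esub> w)"
    by (simp add: free_group_def reduce_append reduced_reduce reduce_reduced reduced_foldr
        foldr_foldr_cancel_cons foldr_reduce)
next
  fix u assume u: "u \<in> carrier (free_group L)"
  have "reduce (inv_word u) \<otimes>\<^bsub>free_group L\<^esub> u = \<one>\<^bsub>free_group L\<^esub>"
    using reduce_inv_word[of u]
    by (simp add: free_group_def reduce_append foldr_reduce reduced_reduce)
  then show "\<exists>v\<in>carrier (free_group L). v \<otimes>\<^bsub>free_group L\<^esub> u = \<one>\<^bsub>free_group L\<^esub>"
    using inv_word_closed[OF u] by blast
qed (auto simp: free_group_def reduce_reduced)

definition free_gen_word :: "'l list \<Rightarrow> 'l free_word" where
  "free_gen_word w = map (\<lambda>a. (a, True)) w"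

definition quot_word :: "'l set \<Rightarrow> 'l list \<Rightarrow> 'l list \<Rightarrow> 'l free_word" where
  "quot_word L \<alpha> \<beta> = free_gen_word \<alpha> \<otimes>\<^bsub>free_group L\<^esub> inv\<^bsub>free_group L\<^esub> (free_gen_word \<beta>)"

text \<open>The formal word \<open>\<alpha> \<beta>\<^sup>-\<^sup>1\<close> is in reduced form, i.e. no cancellation occurs.\<close>

definition reduced_form :: "'l list \<Rightarrow> 'l list \<Rightarrow> bool" where
  "reduced_form \<alpha> \<beta> \<longleftrightarrow> reduced (free_gen_word \<alpha> @ inv_word (free_gen_word \<beta>))"


section \<open>The partial action of the free group\<close>

definition starts_with :: "'l list \<Rightarrow> ('l, 'b) bpath \<Rightarrow> bool" where
  "starts_with \<alpha> \<mu> \<longleftrightarrow> enat (length \<alpha>) \<le> path_length \<mu>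
     \<and> map (\<lambda>i. fst (edge \<mu> i)) [0..<length \<alpha>] = \<alpha>"

text \<open>Every element of the free group has at most one reduced form \<open>\<alpha> \<beta>\<^sup>-\<^sup>1\<close>, so that at most one of
  the alternatives applies to a given \<open>t\<close>, with unique \<open>\<alpha>\<close> and \<open>\<beta>\<close>.\<close>

definition U_set :: "('l, 'b::generalized_boolean_algebra) gbds \<Rightarrow> 'l free_word \<Rightarrow> ('l, 'b) bpath set" where
  "U_set S t = {\<mu> \<in> boundary S.
     t = \<one>\<^bsub>free_group (labels S)\<^esub>
     \<or> (\<exists>\<alpha>\<in>Wpos S. \<exists>\<beta>\<in>Wpos S. reduced_form \<alpha> \<beta> \<and> t = quot_word (labels S) \<alpha> \<beta>
          \<and> starts_with \<alpha> \<mu> \<and> snd (edge \<mu> (length \<alpha> - 1)) \<inter> ideal_word S \<beta> \<noteq> {})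
     \<or> (\<exists>\<alpha>\<in>Wpos S. t = free_gen_word \<alpha> \<and> starts_with \<alpha> \<mu>)
     \<or> (\<exists>\<beta>\<in>Wpos S. t = inv\<^bsub>free_group (labels S)\<^esub> (free_gen_word \<beta>)
          \<and> path_rng S \<mu> \<inter> ideal_word S \<beta> \<noteq> {})}"

text \<open>The edges with labels \<open>\<alpha>\<close> leading to the vertex \<open>\<zeta>\<close>, built from the last one backwards.\<close>

fun lift_edges :: "('l, 'b) gbds \<Rightarrow> 'l list \<Rightarrow> 'b set \<Rightarrow> ('l \<times> 'b set) list" where
  "lift_edges S [] \<zeta> = []"
| "lift_edges S [a] \<zeta> = [(a, \<zeta> \<inter> ideal S a)]"
| "lift_edges S (a # b # w) \<zeta> =
     (let es = lift_edges S (b # w) \<zeta> in (a, pull_filter S b (snd (hd es)) \<inter> ideal S a) # es)"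

fun prepend :: "'e list \<Rightarrow> ('e, 'v) path \<Rightarrow> ('e, 'v) path" where
  "prepend es (Vertex v) = (if es = [] then Vertex v else Finite_Path es)"
| "prepend es (Finite_Path p) = Finite_Path (es @ p)"
| "prepend es (Infinite_Path f) =
     Infinite_Path (\<lambda>i. if i < length es then es ! i else f (i - length es))"

definition move_path :: "('l, 'b::generalized_boolean_algebra) gbds \<Rightarrow> 'l list \<Rightarrow> 'l list
    \<Rightarrow> ('l, 'b) bpath \<Rightarrow> ('l, 'b) bpath" where
  "move_path S \<alpha> \<beta> \<mu> =
     (let \<zeta> = (if \<beta> = [] then path_rng S \<mu> else dom_edge (edge \<mu> (length \<beta> - 1)))
      in prepend (lift_edges S \<alpha> \<zeta>) ((shift ^^ length \<beta>) \<mu>))"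

text \<open>This is only meaningful on the domain \<open>U_set S (inv t)\<close>.\<close>

definition phi :: "('l, 'b::generalized_boolean_algebra) gbds \<Rightarrow> 'l free_word
    \<Rightarrow> ('l, 'b) bpath \<Rightarrow> ('l, 'b) bpath" where
  "phi S t \<mu> = (THE \<nu>. \<exists>\<alpha>\<in>Wstar S. \<exists>\<beta>\<in>Wstar S. reduced_form \<alpha> \<beta>
     \<and> t = quot_word (labels S) \<alpha> \<beta> \<and> \<nu> = move_path S \<alpha> \<beta> \<mu>)"


section \<open>Topological groupoids\<close>

record 'g top_groupoid =
  arrows :: "'g set"
  composable :: "('g \<times> 'g) set"
  gmult :: "'g \<Rightarrow> 'g \<Rightarrow> 'g"
  ginv :: "'g \<Rightarrow> 'g"
  gtop :: "'g topology"

definition groupoid :: "('g, 'm) top_groupoid_scheme \<Rightarrow> bool" where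
  "groupoid G \<longleftrightarrow>
     composable G \<subseteq> arrows G \<times> arrows G
   \<and> (\<forall>(g, h)\<in>composable G. gmult G g h \<in> arrows G)
   \<and> (\<forall>g\<in>arrows G. ginv G g \<in> arrows G \<and> ginv G (ginv G g) = g \<and> (ginv G g, g) \<in> composable G)
   \<and> (\<forall>g h k. (g, h) \<in> composable G \<longrightarrow> (h, k) \<in> composable G \<longrightarrow>
        (gmult G g h, k) \<in> composable G \<and> (g, gmult G h k) \<in> composable G
        \<and> gmult G (gmult G g h) k = gmult G g (gmult G h k))
   \<and> (\<forall>(g, h)\<in>composable G. gmult G (ginv G g) (gmult G g h) = h
        \<and> gmult G (gmult G g h) (ginv G h) = g)"

definition topological_groupoid :: "('g, 'm) top_groupoid_scheme \<Rightarrow> bool" where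
  "topological_groupoid G \<longleftrightarrow> groupoid G \<and> topspace (gtop G) = arrows G
   \<and> continuous_map (subtopology (prod_topology (gtop G) (gtop G)) (composable G)) (gtop G)
       (\<lambda>(g, h). gmult G g h)
   \<and> continuous_map (gtop G) (gtop G) (ginv G)"

definition groupoid_hom ::
    "('g, 'm) top_groupoid_scheme \<Rightarrow> ('h, 'n) top_groupoid_scheme \<Rightarrow> ('g \<Rightarrow> 'h) \<Rightarrow> bool" where
  "groupoid_hom G H f \<longleftrightarrow> f \<in> arrows G \<rightarrow> arrows H
   \<and> (\<forall>(g, h)\<in>composable G. (f g, f h) \<in> composable H \<and> f (gmult G g h) = gmult H (f g) (f h))"

definition topological_groupoid_iso ::
    "('g, 'm) top_groupoid_scheme \<Rightarrow> ('h, 'n) top_groupoid_scheme \<Rightarrow> ('g \<Rightarrow> 'h) \<Rightarrow> bool" where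
  "topological_groupoid_iso G H f \<longleftrightarrow> topological_groupoid G \<and> topological_groupoid H
   \<and> (\<exists>f'. homeomorphic_maps (gtop G) (gtop H) f f' \<and> groupoid_hom G H f \<and> groupoid_hom H G f')"


section \<open>The two groupoids and the map between them\<close>

definition transformation_arrows :: "('l, 'b::generalized_boolean_algebra) gbds
    \<Rightarrow> (('l, 'b) bpath \<times> 'l free_word \<times> ('l, 'b) bpath) set" where
  "transformation_arrows S = {(\<mu>, t, \<nu>). \<mu> \<in> boundary S \<and> t \<in> carrier (free_group (labels S))
     \<and> \<nu> \<in> boundary S \<and> \<nu> \<in> U_set S (inv\<^bsub>free_group (labels S)\<^esub> t) \<and> \<mu> = phi S t \<nu>}"

definition transformation_groupoid :: "('l, 'b::generalized_boolean_algebra) gbds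
    \<Rightarrow> (('l, 'b) bpath \<times> 'l free_word \<times> ('l, 'b) bpath) top_groupoid" where
  "transformation_groupoid S =
     \<lparr>arrows = transformation_arrows S,
      composable = {((\<mu>, t, \<nu>), (\<nu>', s, \<delta>)). (\<mu>, t, \<nu>) \<in> transformation_arrows S
        \<and> (\<nu>', s, \<delta>) \<in> transformation_arrows S \<and> \<nu> = \<nu>'},
      gmult = (\<lambda>(\<mu>, t, \<nu>) (\<nu>', s, \<delta>). (\<mu>, t \<otimes>\<^bsub>free_group (labels S)\<^esub> s, \<delta>)),
      ginv = (\<lambda>(\<mu>, t, \<nu>). (\<nu>, inv\<^bsub>free_group (labels S)\<^esub> t, \<mu>)),
      gtop = subtopology
        (prod_topology (boundary_top S)
          (prod_topology (discrete_topology (carrier (free_group (labels S)))) (boundary_top S)))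
        (transformation_arrows S)\<rparr>"

definition shift_arrows :: "('l, 'b::generalized_boolean_algebra) gbds
    \<Rightarrow> (('l, 'b) bpath \<times> int \<times> ('l, 'b) bpath) set" where
  "shift_arrows S = {(\<mu>, int k - int l, \<nu>) | \<mu> k l \<nu>.
     \<mu> \<in> shift_domain S k \<and> \<nu> \<in> shift_domain S l \<and> (shift ^^ k) \<mu> = (shift ^^ l) \<nu>}"

definition shift_groupoid :: "('l, 'b::generalized_boolean_algebra) gbds
    \<Rightarrow> (('l, 'b) bpath \<times> int \<times> ('l, 'b) bpath) top_groupoid" where
  "shift_groupoid S =
     \<lparr>arrows = shift_arrows S,
      composable = {((\<mu>, n, \<nu>), (\<nu>', m, \<delta>)). (\<mu>, n, \<nu>) \<in> shift_arrows S
        \<and> (\<nu>', m, \<delta>) \<in> shift_arrows S \<and> \<nu> = \<nu>'},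
      gmult = (\<lambda>(\<mu>, n, \<nu>) (\<nu>', m, \<delta>). (\<mu>, n + m, \<delta>)),
      ginv = (\<lambda>(\<mu>, n, \<nu>). (\<nu>, - n, \<mu>)),
      gtop = topology_generated_by
        {{(\<mu>, int k - int l, \<nu>) | \<mu> \<nu>. \<mu> \<in> U \<and> \<nu> \<in> V \<and> (shift ^^ k) \<mu> = (shift ^^ l) \<nu>} | U V k l.
           openin (boundary_top S) U \<and> U \<subseteq> shift_domain S k \<and> inj_on (shift ^^ k) U
         \<and> openin (boundary_top S) V \<and> V \<subseteq> shift_domain S l \<and> inj_on (shift ^^ l) V}\<rparr>"

definition Theta :: "('l, 'b::generalized_boolean_algebra) gbds
    \<Rightarrow> ('l, 'b) bpath \<times> 'l free_word \<times> ('l, 'b) bpath \<Rightarrow> ('l, 'b) bpath \<times> int \<times> ('l, 'b) bpath" where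
  "Theta S = (\<lambda>(\<mu>, t, \<nu>). THE y. \<exists>\<alpha>\<in>Wstar S. \<exists>\<beta>\<in>Wstar S.
     t = quot_word (labels S) \<alpha> \<beta> \<and> y = (\<mu>, int (length \<alpha>) - int (length \<beta>), \<nu>))"

end

(* Call \<mu> and \<nu> tail equal along (\<alpha>, \<beta>) if they start with the words \<alpha> and \<beta> and agree once these
   initial segments are removed. A path is determined by its initial word and the remaining path, so
   the arrows of the partial action are exactly the triples (\<mu>, \<alpha> \<beta>\<^sup>-\<^sup>1, \<nu>) with \<mu> and \<nu> tail equal
   along (\<alpha>, \<beta>), where \<alpha> \<beta>\<^sup>-\<^sup>1 need not be reduced. On these, Theta is the degree map of the free
   group on the middle coordinate. It is bijective because the first k labels of \<mu> and l labels of \<nu>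
   recover the group element from k - l, \<mu> and \<nu>. Since the cylinder sets of words are open and the
   k-th power of the shift is injective on the cylinder of a word of length k, Theta is continuous
   and open; the topological groupoid structure is then transported along Theta from the
   transformation groupoid, where it is inherited from a product. *)

theory Submission
  imports Defs
begin

section \<open>Ultrafilters and ideals\<close>

text \<open>An edge \<open>(a, \<eta>)\<close> is determined by its label and its domain vertex,
  because \<eta> is the intersection of that vertex with \<open>ideal S a\<close>. This is why a
  path can be recovered from its initial word and the remaining path. Conversely, a non-empty word
  \<open>w\<close> over the labels can be put in front of a boundary path \<nu> exactly when the
  range of \<nu> meets \<open>ideal_word S w\<close>. Uniqueness and existence of lifts together
  turn the edge-by-edge formulas for \<open>U_set\<close> and \<open>phi\<close> into tail equality.

  The obstacle is that these formulas speak of reduced forms only, while composing two arrows, or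
  working with prescribed powers of the shift, forces longer words. A common suffix cancels in the
  free group; it can be removed from a tail equality by uniqueness of lifts, and added to one
  whenever the common remaining path starts with it. Passing between words of different lengths in
  this way replaces any computation with \<open>phi\<close>.

  The range of a path may be \<open>{}\<close>, the extra point of \<open>F0 S\<close>, which is not
  an ultrafilter. Statements about ranges therefore come with a non-emptiness condition.\<close>

lemma gba_diff_le: "A - B \<le> (A::'b::generalized_boolean_algebra)"
  by (metis sup_inf_diff sup_ge2)

lemma gba_inf_diff: "inf (A - B) B = (bot::'b::generalized_boolean_algebra)"
proof -
  have "inf (A - B) B = inf (inf A B) (A - B)"
    by (metis gba_diff_le inf.absorb2 inf.assoc inf.commute)
  then show ?thesis by (simp add: inf_inf_diff)
qed

lemma gba_inf_diff_eq_bot: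
  fixes A :: "'b::generalized_boolean_algebra"
  assumes "inf D (A - B) = bot"
  shows "inf D A = inf D (inf A B)"
proof -
  have "inf D A = inf D (sup (inf A B) (A - B))" by (simp add: sup_inf_diff)
  then show ?thesis by (simp add: inf_sup_distrib1 assms)
qed

lemma ba_ideal_downward: "ba_ideal J \<Longrightarrow> A \<in> J \<Longrightarrow> B \<le> A \<Longrightarrow> B \<in> J"
  unfolding ba_ideal_def by (metis inf.absorb2)

lemma ba_ideal_UNIV: "ba_ideal UNIV"
  by (simp add: ba_ideal_def)

lemma filter_inD:
  assumes "filter_in J \<xi>"
  shows "\<xi> \<subseteq> J" "\<xi> \<noteq> {}" "bot \<notin> \<xi>"
    and "\<And>A B. A \<in> \<xi> \<Longrightarrow> B \<in> J \<Longrightarrow> A \<le> B \<Longrightarrow> B \<in> \<xi>"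
    and "\<And>A B. A \<in> \<xi> \<Longrightarrow> B \<in> \<xi> \<Longrightarrow> inf A B \<in> \<xi>"
  using assms unfolding filter_in_def by auto

lemma ultrafilter_imp_filter: "\<xi> \<in> ultrafilters_in J \<Longrightarrow> filter_in J \<xi>"
  by (simp add: ultrafilters_in_def)

text \<open>There is no unit, so complements are taken relative to a member \<open>A\<close> of
  \<xi>. The dichotomy gives maximality: if \<open>C\<close> lies in a larger filter, then
  \<open>A - C\<close> does not, being disjoint from \<open>C\<close>, so \<open>inf A C\<close>
  lies in \<xi> and hence \<open>C\<close> does.\<close>

lemma ultrafilters_in_iff:
  assumes "ba_ideal J"
  shows "\<xi> \<in> ultrafilters_in J \<longleftrightarrow> filter_in J \<xi> \<and> (\<forall>A\<in>\<xi>. \<forall>B. inf A B \<in> \<xi> \<or> A - B \<in> \<xi>)"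
proof (intro iffI conjI ballI allI)
  assume \<xi>: "\<xi> \<in> ultrafilters_in J"
  then show fil: "filter_in J \<xi>" by (simp add: ultrafilters_in_def)
  fix A B assume A: "A \<in> \<xi>"
  \<comment> \<open>The upward closure in \<open>J\<close> of the meets of members of \<xi> with
    \<open>A - B\<close>. If it contains \<open>bot\<close>, some \<open>D\<close> in \<xi> meets
    \<open>A\<close> only inside \<open>B\<close>, which forces \<open>inf A B\<close> into \<xi>.
    Otherwise it is a filter containing \<xi>, and maximality puts \<open>A - B\<close> into
    \<xi>.\<close>
  define G where "G = {C \<in> J. \<exists>D\<in>\<xi>. inf D (A - B) \<le> C}"
  have AJ: "A \<in> J" using A filter_inD(1)[OF fil] by blast
  have sub: "\<xi> \<subseteq> G"
    using filter_inD(1)[OF fil] unfolding G_def by (blast intro: inf_le1)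
  have diff: "A - B \<in> G"
    using A ba_ideal_downward[OF assms AJ gba_diff_le] by (auto simp: G_def)
  show "inf A B \<in> \<xi> \<or> A - B \<in> \<xi>"
  proof (cases "bot \<in> G")
    case True
    then obtain D where D: "D \<in> \<xi>" "inf D (A - B) = bot"
      by (auto simp: G_def bot_unique)
    have "inf D A \<in> \<xi>" using filter_inD(5)[OF fil D(1) A] .
    moreover have "inf A B \<in> J" by (rule ba_ideal_downward[OF assms AJ]) simp
    moreover have "inf D A \<le> inf A B" unfolding gba_inf_diff_eq_bot[OF D(2)] by (rule inf_le2)
    ultimately have "inf A B \<in> \<xi>" by (rule filter_inD(4)[OF fil])
    then show ?thesis ..
  next
    case False
    have "filter_in J G"
      unfolding filter_in_def
    proof (intro conjI ballI impI)
      fix C D assume "C \<in> G" "D \<in> G"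
      then obtain C' D' where CD: "C \<in> J" "C' \<in> \<xi>" "inf C' (A - B) \<le> C"
          "D' \<in> \<xi>" "inf D' (A - B) \<le> D"
        by (auto simp: G_def)
      have "inf C' D' \<in> \<xi>" using filter_inD(5)[OF fil] CD by blast
      moreover have "inf (inf C' D') (A - B) \<le> inf C D"
        using CD(3,5) by (meson inf.boundedI inf.cobounded1 inf.cobounded2 inf_mono order_refl order_trans)
      moreover have "inf C D \<in> J" by (rule ba_ideal_downward[OF assms CD(1)]) simp
      ultimately show "inf C D \<in> G" by (auto simp: G_def)
    next
      show "G \<noteq> {}" using diff by blast
    qed (use False in \<open>auto simp: G_def intro: order_trans\<close>)
    then have "G = \<xi>" using \<xi> sub by (simp add: ultrafilters_in_def)
    then show ?thesis using diff by simp
  qed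
next
  assume *: "filter_in J \<xi> \<and> (\<forall>A\<in>\<xi>. \<forall>B. inf A B \<in> \<xi> \<or> A - B \<in> \<xi>)"
  have "\<G> = \<xi>" if \<G>: "filter_in J \<G>" "\<xi> \<subseteq> \<G>" for \<G>
  proof (rule antisym[OF subsetI \<G>(2)])
    fix C assume C: "C \<in> \<G>"
    obtain A where A: "A \<in> \<xi>" using * filter_inD(2) by blast
    have "A - C \<notin> \<xi>"
    proof
      assume "A - C \<in> \<xi>"
      then have "inf (A - C) C \<in> \<G>" using C \<G> filter_inD(5) by blast
      then show False using filter_inD(3)[OF \<G>(1)] by (simp add: gba_inf_diff)
    qed
    then have "inf A C \<in> \<xi>" using * A by blast
    moreover have "C \<in> J" using C filter_inD(1)[OF \<G>(1)] by blast
    ultimately show "C \<in> \<xi>" using * filter_inD(4) inf_le2 by blast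
  qed
  then show "\<xi> \<in> ultrafilters_in J" using * by (simp add: ultrafilters_in_def)
qed

text \<open>The dichotomy of \<open>ultrafilters_in_iff\<close> survives the restriction: for
  \<open>A\<close> in \<open>J\<close>, both \<open>inf A B\<close> and \<open>A - B\<close> lie
  below \<open>A\<close> and so remain in the ideal.\<close>

lemma ultrafilter_restrict:
  assumes "\<zeta> \<in> ultrafilters_in UNIV" "ba_ideal J" "\<zeta> \<inter> J \<noteq> {}"
  shows "\<zeta> \<inter> J \<in> ultrafilters_in J"
proof -
  have *: "filter_in UNIV \<zeta>" "\<forall>A\<in>\<zeta>. \<forall>B. inf A B \<in> \<zeta> \<or> A - B \<in> \<zeta>"
    using assms(1) by (simp_all add: ultrafilters_in_iff[OF ba_ideal_UNIV])
  have down: "inf A B \<in> J" "A - B \<in> J" if "A \<in> J" for A B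
    using that assms(2) gba_diff_le by (auto intro: ba_ideal_downward)
  have "filter_in J (\<zeta> \<inter> J)"
    unfolding filter_in_def
  proof (intro conjI ballI impI)
    fix A B assume "A \<in> \<zeta> \<inter> J" "B \<in> J" "A \<le> B"
    then show "B \<in> \<zeta> \<inter> J" using filter_inD(4)[OF *(1), of A B] by simp
  next
    fix A B assume "A \<in> \<zeta> \<inter> J" "B \<in> \<zeta> \<inter> J"
    then show "inf A B \<in> \<zeta> \<inter> J" using filter_inD(5)[OF *(1), of A B] down(1) by simp
  qed (use assms(3) filter_inD(3)[OF *(1)] in auto)
  then show ?thesis
    using *(2) down by (auto simp: ultrafilters_in_iff[OF assms(2)])
qed

text \<open>With \<open>A\<close> fixed in \<open>\<zeta> \<inter> J\<close>, each \<open>C\<close>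
  in \<zeta> lies above \<open>inf A C\<close>, which is again in \<open>\<zeta> \<inter> J\<close>.
  Together with \<open>dom_edge_Int_ideal\<close> this makes restriction to the ideal and upward
  closure mutually inverse.\<close>

lemma dom_edge_restrict:
  assumes "\<zeta> \<in> ultrafilters_in UNIV" "ba_ideal J" "\<zeta> \<inter> J \<noteq> {}"
  shows "dom_edge (a, \<zeta> \<inter> J) = \<zeta>"
proof -
  have fil: "filter_in UNIV \<zeta>" using assms(1) by (rule ultrafilter_imp_filter)
  obtain A where A: "A \<in> \<zeta>" "A \<in> J" using assms(3) by blast
  have "\<exists>B\<in>\<zeta> \<inter> J. B \<le> C" if "C \<in> \<zeta>" for C
  proof
    show "inf A C \<in> \<zeta> \<inter> J"
      using filter_inD(5)[OF fil A(1) that] ba_ideal_downward[OF assms(2) A(2)] by simp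
  qed simp
  then show ?thesis using filter_inD(4)[OF fil] unfolding dom_edge_def snd_conv by blast
qed

lemma dom_edge_Int_ideal:
  assumes "filter_in J \<eta>"
  shows "dom_edge (a, \<eta>) \<inter> J = \<eta>"
  using filter_inD(1,4)[OF assms] unfolding dom_edge_def snd_conv by blast

lemma topspace_ultrafilter_topology [simp]:
  "topspace (ultrafilter_topology J) = ultrafilters_in J"
proof -
  have "\<exists>A\<in>J. A \<in> \<xi>" if "\<xi> \<in> ultrafilters_in J" for \<xi>
  proof -
    have "\<xi> \<subseteq> J" "\<xi> \<noteq> {}" using filter_inD(1,2)[OF ultrafilter_imp_filter[OF that]] .
    then show ?thesis by blast
  qed
  then have "(\<Union>A\<in>J. {\<xi> \<in> ultrafilters_in J. A \<in> \<xi>}) = ultrafilters_in J" by fast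
  then show ?thesis
    by (simp only: ultrafilter_topology_def topology_generated_by_topspace Setcompr_eq_image)
qed


section \<open>Words in the free group\<close>

text \<open>Letters of equal sign never cancel, so a cancellation can occur only at the junction,
  where the last letter of \<alpha> meets the inverse of the last letter of \<beta>.\<close>

lemma reduced_form_iff: "reduced_form \<alpha> \<beta> \<longleftrightarrow> \<alpha> = [] \<or> \<beta> = [] \<or> last \<alpha> \<noteq> last \<beta>"
proof -
  have *: "successively (\<lambda>x y. \<not> y = inv_letter x) (map (\<lambda>a. (a, True)) u)"
    "successively (\<lambda>x y. \<not> y = inv_letter x) (map (\<lambda>a. (a, False)) u)" for u :: "'a list"
    by (auto simp: successively_map inv_letter_def successively_conv_nth)
  have "rev (map inv_letter (map (\<lambda>a. (a, True)) \<beta>)) = map (\<lambda>a. (a, False)) (rev \<beta>)"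
    by (simp add: rev_map inv_letter_def)
  then show ?thesis
    using * by (auto simp: reduced_form_def reduced_def free_gen_word_def inv_word_def
      successively_append_iff last_map hd_map hd_rev inv_letter_def)
qed

lemma reduced_form_sym: "reduced_form \<alpha> \<beta> \<longleftrightarrow> reduced_form \<beta> \<alpha>"
  by (auto simp: reduced_form_iff)

lemma reduced_free_gen_word: "reduced (free_gen_word w)"
  by (auto simp: reduced_def free_gen_word_def successively_map inv_letter_def successively_conv_nth)

lemma free_gen_word_closed [simp, intro]:
  "w \<in> lists L \<Longrightarrow> free_gen_word w \<in> carrier (free_group L)"
  using reduced_free_gen_word[of w] by (auto simp: free_group_def free_gen_word_def)

lemma free_gen_word_append:
  "free_gen_word (u @ v) = free_gen_word u \<otimes>\<^bsub>free_group L\<^esub> free_gen_word v"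
  using reduce_reduced[OF reduced_free_gen_word, of "u @ v"] by (simp add: free_group_def free_gen_word_def)

lemma inv_free_gen_word:
  assumes "w \<in> lists L"
  shows "inv\<^bsub>free_group L\<^esub> (free_gen_word w) = map (\<lambda>a. (a, False)) (rev w)"
proof -
  have eq: "inv_word (free_gen_word w) = map (\<lambda>a. (a, False)) (rev w)"
    by (simp add: inv_word_def free_gen_word_def rev_map inv_letter_def)
  have red: "reduced (inv_word (free_gen_word w))"
    unfolding eq reduced_def by (auto simp: successively_map inv_letter_def successively_conv_nth)
  have "inv_word (free_gen_word w) \<in> carrier (free_group L)"
    using inv_word_closed[OF free_gen_word_closed[OF assms]] by (simp add: reduce_reduced red)
  moreover have "inv_word (free_gen_word w) \<otimes>\<^bsub>free_group L\<^esub> free_gen_word w = \<one>\<^bsub>free_group L\<^esub>"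
    using reduce_inv_word by (simp add: free_group_def)
  ultimately show ?thesis
    using group.inv_equality[OF group_free_group _ free_gen_word_closed[OF assms]] eq by simp
qed

lemma quot_word_closed [simp, intro]:
  assumes "\<alpha> \<in> lists L" "\<beta> \<in> lists L"
  shows "quot_word L \<alpha> \<beta> \<in> carrier (free_group L)"
proof -
  interpret group "free_group L" by (rule group_free_group)
  show ?thesis using assms by (simp add: quot_word_def)
qed

lemma inv_quot_word:
  assumes "\<alpha> \<in> lists L" "\<beta> \<in> lists L"
  shows "inv\<^bsub>free_group L\<^esub> (quot_word L \<alpha> \<beta>) = quot_word L \<beta> \<alpha>"
proof -
  interpret group "free_group L" by (rule group_free_group)
  show ?thesis using assms by (simp add: quot_word_def inv_mult_group)
qed

lemma quot_word_mult:
  assumes "\<alpha> \<in> lists L" "\<beta> \<in> lists L" "\<gamma> \<in> lists L"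
  shows "quot_word L \<alpha> \<beta> \<otimes>\<^bsub>free_group L\<^esub> quot_word L \<beta> \<gamma> = quot_word L \<alpha> \<gamma>"
proof -
  interpret group "free_group L" by (rule group_free_group)
  show ?thesis using assms by (simp add: quot_word_def m_assoc inv_solve_left')
qed

lemma quot_word_append:
  assumes "\<alpha> \<in> lists L" "\<beta> \<in> lists L" "\<gamma> \<in> lists L"
  shows "quot_word L (\<alpha> @ \<gamma>) (\<beta> @ \<gamma>) = quot_word L \<alpha> \<beta>"
proof -
  interpret group "free_group L" by (rule group_free_group)
  have "free_gen_word \<gamma> \<otimes>\<^bsub>free_group L\<^esub> (inv\<^bsub>free_group L\<^esub> free_gen_word \<gamma>
      \<otimes>\<^bsub>free_group L\<^esub> inv\<^bsub>free_group L\<^esub> free_gen_word \<beta>) = inv\<^bsub>free_group L\<^esub> free_gen_word \<beta>"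
    using assms by (simp flip: m_assoc)
  then show ?thesis
    using assms by (simp add: quot_word_def free_gen_word_append[of _ _ L] inv_mult_group m_assoc)
qed

lemma quot_word_Nil:
  assumes "\<alpha> \<in> lists L"
  shows "quot_word L \<alpha> [] = free_gen_word \<alpha>"
    and "quot_word L [] \<alpha> = inv\<^bsub>free_group L\<^esub> (free_gen_word \<alpha>)"
proof -
  interpret group "free_group L" by (rule group_free_group)
  have [simp]: "free_gen_word [] = \<one>\<^bsub>free_group L\<^esub>" by (simp add: free_gen_word_def free_group_def)
  show "quot_word L \<alpha> [] = free_gen_word \<alpha>" "quot_word L [] \<alpha> = inv\<^bsub>free_group L\<^esub> (free_gen_word \<alpha>)"
    using assms by (simp_all add: quot_word_def)
qed

lemma quot_word_reduced:
  assumes "\<beta> \<in> lists L" "reduced_form \<alpha> \<beta>"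
  shows "quot_word L \<alpha> \<beta> = map (\<lambda>a. (a, True)) \<alpha> @ map (\<lambda>a. (a, False)) (rev \<beta>)"
proof -
  have "inv_word (free_gen_word \<beta>) = map (\<lambda>a. (a, False)) (rev \<beta>)"
    by (simp add: inv_word_def free_gen_word_def rev_map inv_letter_def)
  then have "reduced (map (\<lambda>a. (a, True)) \<alpha> @ map (\<lambda>a. (a, False)) (rev \<beta>))"
    using assms(2) by (simp add: reduced_form_def free_gen_word_def)
  then show ?thesis
    using inv_free_gen_word[OF assms(1)]
    by (simp add: quot_word_def free_group_def free_gen_word_def reduce_reduced)
qed

text \<open>In a reduced form the positive letters spell \<alpha> and the negative ones spell
  \<beta> backwards, so filtering by sign recovers both words.\<close>

lemma quot_word_reduced_inj:
  assumes "\<beta> \<in> lists L" "\<beta>' \<in> lists L" "reduced_form \<alpha> \<beta>" "reduced_form \<alpha>' \<beta>'"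
    and "quot_word L \<alpha> \<beta> = quot_word L \<alpha>' \<beta>'"
  shows "\<alpha> = \<alpha>'" "\<beta> = \<beta>'"
proof -
  have 1: "filter snd (map (\<lambda>a. (a, True)) u @ map (\<lambda>a. (a, False)) v) = map (\<lambda>a. (a, True)) u"
    "filter (\<lambda>x. \<not> snd x) (map (\<lambda>a. (a, True)) u @ map (\<lambda>a. (a, False)) v) = map (\<lambda>a. (a, False)) v"
    for u v :: "'a list" by (simp_all add: filter_map o_def)
  have eq: "map (\<lambda>a. (a, True)) \<alpha> @ map (\<lambda>a. (a, False)) (rev \<beta>)
      = map (\<lambda>a. (a, True)) \<alpha>' @ map (\<lambda>a. (a, False)) (rev \<beta>')"
    using assms by (simp add: quot_word_reduced)
  have "map (\<lambda>a. (a, True)) \<alpha> = map (\<lambda>a. (a, True)) \<alpha>'"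
    "map (\<lambda>a. (a, False)) (rev \<beta>) = map (\<lambda>a. (a, False)) (rev \<beta>')"
    using arg_cong[OF eq, of "filter snd"] arg_cong[OF eq, of "filter (\<lambda>x. \<not> snd x)"]
    unfolding 1 by blast+
  then show "\<alpha> = \<alpha>'" "\<beta> = \<beta>'" by (auto dest: map_injective simp: inj_def)
qed

text \<open>The part that cancels is the longest common suffix \<gamma> of the two words; what is
  left over has no common last letter.\<close>

lemma quot_word_reduced_form:
  assumes "\<alpha> \<in> lists L" "\<beta> \<in> lists L"
  obtains \<alpha>' \<beta>' \<gamma> where "\<alpha> = \<alpha>' @ \<gamma>" "\<beta> = \<beta>' @ \<gamma>" "reduced_form \<alpha>' \<beta>'"
    "quot_word L \<alpha> \<beta> = quot_word L \<alpha>' \<beta>'"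
proof -
  obtain \<alpha>' \<beta>' \<gamma> where *: "\<alpha> = \<alpha>' @ \<gamma>" "\<beta> = \<beta>' @ \<gamma>" "reduced_form \<alpha>' \<beta>'"
    using longest_common_suffix[of \<alpha> \<beta>] unfolding reduced_form_iff by blast
  have "quot_word L \<alpha> \<beta> = quot_word L \<alpha>' \<beta>'"
    using assms quot_word_append[of \<alpha>' L \<beta>' \<gamma>] * by simp
  then show thesis using * that by blast
qed

text \<open>The homomorphism from the free group to the integers with value 1 on every
  generator.\<close>

definition word_degree :: "'l free_word \<Rightarrow> int" where
  "word_degree w = (\<Sum>x\<leftarrow>w. if snd x then 1 else - 1)"

text \<open>A cancelled pair of letters contributes 1 and -1, so reduction does not change the
  degree.\<close>

lemma word_degree_cancel_cons: "word_degree (cancel_cons x w) = word_degree (x # w)"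
  by (cases w) (auto simp: word_degree_def inv_letter_def)

lemma word_degree_reduce: "word_degree (reduce w) = word_degree w"
proof (induction w)
  case (Cons x w)
  then show ?case
    using word_degree_cancel_cons[of x "reduce w"] by (simp add: reduce_def word_degree_def)
qed (simp add: reduce_def)

lemma word_degree_quot_word:
  assumes "\<beta> \<in> lists L"
  shows "word_degree (quot_word L \<alpha> \<beta>) = int (length \<alpha>) - int (length \<beta>)"
proof -
  have sums: "(\<Sum>a\<leftarrow>w. 1) = int (length w)" "(\<Sum>a\<leftarrow>w. - 1) = - int (length w)" for w :: "'a list"
    by (induction w) auto
  have "quot_word L \<alpha> \<beta> = reduce (map (\<lambda>a. (a, True)) \<alpha> @ map (\<lambda>a. (a, False)) (rev \<beta>))"
    unfolding quot_word_def inv_free_gen_word[OF assms] by (simp add: free_group_def free_gen_word_def)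
  then have "word_degree (quot_word L \<alpha> \<beta>) = (\<Sum>a\<leftarrow>\<alpha>. 1) + (\<Sum>a\<leftarrow>rev \<beta>. - 1)"
    by (simp only: word_degree_reduce) (simp add: word_degree_def o_def)
  then show ?thesis unfolding sums by simp
qed

lemma word_degree_mult: "word_degree (t \<otimes>\<^bsub>free_group L\<^esub> s) = word_degree t + word_degree s"
  by (simp add: free_group_def word_degree_reduce) (simp add: word_degree_def)

lemma word_degree_inv:
  assumes "t \<in> carrier (free_group L)"
  shows "word_degree (inv\<^bsub>free_group L\<^esub> t) = - word_degree t"
proof -
  interpret group "free_group L" by (rule group_free_group)
  have "word_degree (inv\<^bsub>free_group L\<^esub> t \<otimes>\<^bsub>free_group L\<^esub> t) = 0"
    using assms by (simp add: l_inv) (simp add: free_group_def word_degree_def)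
  then show ?thesis by (simp add: word_degree_mult)
qed


section \<open>Boundary paths\<close>

lemma boundary_iff:
  "Vertex v \<in> boundary S \<longleftrightarrow> v \<in> E0_sg S"
  "Finite_Path p \<in> boundary S \<longleftrightarrow> p \<noteq> [] \<and> set p \<subseteq> E1 S
     \<and> (\<forall>i. Suc i < length p \<longrightarrow> dom_edge (p ! i) = rng_edge S (p ! Suc i))
     \<and> dom_edge (last p) \<in> E0_sg S"
  "Infinite_Path f \<in> boundary S \<longleftrightarrow> (\<forall>i. f i \<in> E1 S \<and> dom_edge (f i) = rng_edge S (f (Suc i)))"
  by (auto simp: boundary_def E_inf_def E_star_def E_n_def E0_sg_def split: if_splits)

lemma prepend_Nil [simp]: "prepend [] \<nu> = \<nu>"
  by (cases \<nu>) auto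

lemma prepend_Cons: "prepend (e # es) \<nu> = prepend [e] (prepend es \<nu>)"
  by (cases \<nu>) (auto simp: fun_eq_iff nth_Cons split: nat.splits)

lemma prepend_edge_neq_Vertex [simp]: "prepend [e] \<nu> \<noteq> Vertex v"
  by (cases \<nu>) auto

lemma path_rng_prepend_edge [simp]: "path_rng S (prepend [e] \<nu>) = rng_edge S e"
  by (cases \<nu>) auto

lemma path_length_prepend_edge [simp]: "path_length (prepend [e] \<nu>) = eSuc (path_length \<nu>)"
  by (cases \<nu>) (auto simp: eSuc_enat zero_enat_def)

lemma edge_prepend_edge:
  "edge (prepend [e] \<nu>) 0 = e"
  "enat i < path_length \<nu> \<Longrightarrow> edge (prepend [e] \<nu>) (Suc i) = edge \<nu> i"
  by (cases \<nu>; simp add: zero_enat_def)+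

lemma prepend_edge_boundary:
  assumes "\<nu> \<in> boundary S" "e \<in> E1 S" "dom_edge e = path_rng S \<nu>"
  shows "prepend [e] \<nu> \<in> boundary S"
proof (cases \<nu>)
  case (Finite_Path p)
  then show ?thesis using assms
    by (auto simp: boundary_iff nth_Cons hd_conv_nth split: nat.splits)
qed (use assms in \<open>auto simp: boundary_iff split: nat.splits\<close>)

text \<open>The condition on \<open>dom_edge e\<close> matters when \<nu> is a vertex: the shift of
  a single edge is the vertex \<open>dom_edge e\<close>.\<close>

lemma shift_prepend_edge:
  assumes "\<nu> \<in> boundary S" "dom_edge e = path_rng S \<nu>"
  shows "shift (prepend [e] \<nu>) = \<nu>"
  using assms by (cases \<nu>) (auto simp: boundary_iff Suc_le_eq)

text \<open>Replaces the three kinds of paths by two cases, a vertex or a first edge followed by a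
  boundary path, which is the form needed for inductions over words. A path of length one is its
  edge put in front of the vertex \<open>dom_edge e\<close>.\<close>

lemma boundary_cases [consumes 1, case_names vertex edge]:
  assumes "\<mu> \<in> boundary S"
  obtains v where "\<mu> = Vertex v" "v \<in> E0_sg S"
  | e \<nu> where "\<mu> = prepend [e] \<nu>" "e \<in> E1 S" "\<nu> \<in> boundary S" "dom_edge e = path_rng S \<nu>"
proof (cases \<mu>)
  case (Vertex v)
  then show ?thesis using assms that(1) by (simp add: boundary_iff)
next
  case (Finite_Path p)
  then obtain e q where p: "p = e # q" using assms by (cases p) (auto simp: boundary_iff)
  show ?thesis
  proof (cases "q = []")
    case True
    then show ?thesis
      using that(2)[of e "Vertex (dom_edge e)"] assms Finite_Path p by (auto simp: boundary_iff)
  next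
    case False
    have dom: "dom_edge (p ! i) = rng_edge S (p ! Suc i)" if "Suc i < length p" for i
      using that assms Finite_Path by (auto simp: boundary_iff)
    have "Finite_Path q \<in> boundary S" "e \<in> E1 S"
      using assms Finite_Path p False dom[of "Suc i" for i] by (auto simp: boundary_iff)
    then show ?thesis
      using that(2)[of e "Finite_Path q"] dom[of 0] Finite_Path p False by (auto simp: hd_conv_nth)
  qed
next
  case (Infinite_Path f)
  have "prepend [f 0] (Infinite_Path (\<lambda>i. f (Suc i))) = \<mu>"
    using Infinite_Path by (auto simp: fun_eq_iff less_Suc_eq_0_disj gr0_conv_Suc)
  then show ?thesis
    using that(2)[of "f 0" "Infinite_Path (\<lambda>i. f (Suc i))"] assms Infinite_Path
    by (auto simp: boundary_iff)
qed

lemma starts_with_Nil [simp]: "starts_with [] \<mu>"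
  by (simp add: starts_with_def zero_enat_def[symmetric])

lemma starts_with_Cons_Vertex [simp]: "\<not> starts_with (a # w) (Vertex v)"
  by (simp add: starts_with_def zero_enat_def)

lemma starts_with_Cons_prepend_edge [simp]:
  "starts_with (a # w) (prepend [e] \<nu>) \<longleftrightarrow> fst e = a \<and> starts_with w \<nu>"
proof -
  \<comment> \<open>Past the end of a finite path the value of \<open>edge\<close> is unspecified,
    so the index shift is justified only up to the length of \<nu>.\<close>
  have "map (\<lambda>i. fst (edge (prepend [e] \<nu>) i)) [0..<Suc (length w)]
      = fst e # map (\<lambda>i. fst (edge \<nu> i)) [0..<length w]" if "enat (length w) \<le> path_length \<nu>"
  proof -
    have "edge (prepend [e] \<nu>) (Suc i) = edge \<nu> i" if "i < length w" for i
      using that \<open>enat (length w) \<le> path_length \<nu>\<close>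
      by (intro edge_prepend_edge(2)) (rule less_le_trans, auto)
    then show ?thesis
      unfolding map_upt_Suc edge_prepend_edge(1) by simp
  qed
  then show ?thesis
    using eSuc_ile_mono[of "enat (length w)" "path_length \<nu>"]
    unfolding starts_with_def path_length_prepend_edge list.size add_Suc_right add_0_right eSuc_enat
    by (metis list.inject)
qed

lemma starts_with_ConsE:
  assumes "\<mu> \<in> boundary S" "starts_with (a # w) \<mu>"
  obtains \<eta> \<nu> where "\<mu> = prepend [(a, \<eta>)] \<nu>" "(a, \<eta>) \<in> E1 S" "\<nu> \<in> boundary S"
    "dom_edge (a, \<eta>) = path_rng S \<nu>" "shift \<mu> = \<nu>" "starts_with w \<nu>"
  using assms(1)
proof (cases rule: boundary_cases)
  case (edge e \<nu>)
  then show ?thesis using that[of "snd e" \<nu>] assms by (cases e) (auto simp: shift_prepend_edge)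
qed (use assms in auto)

lemma funpow_shift_boundary:
  "\<mu> \<in> boundary S \<Longrightarrow> starts_with w \<mu> \<Longrightarrow> (shift ^^ length w) \<mu> \<in> boundary S"
proof (induction w arbitrary: \<mu>)
  case (Cons a w)
  from Cons.prems obtain \<nu> where "\<nu> \<in> boundary S" "shift \<mu> = \<nu>" "starts_with w \<nu>"
    by (rule starts_with_ConsE)
  then show ?case using Cons.IH by (simp add: funpow_Suc_right del: funpow.simps(2))
qed simp

lemma starts_with_append:
  "\<mu> \<in> boundary S \<Longrightarrow>
    starts_with (u @ v) \<mu> \<longleftrightarrow> starts_with u \<mu> \<and> starts_with v ((shift ^^ length u) \<mu>)"
proof (induction u arbitrary: \<mu>)
  case (Cons a u)
  show ?case
    using Cons.prems
  proof (cases rule: boundary_cases)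
    case (edge e \<nu>)
    then show ?thesis
      using Cons.IH[of \<nu>] by (auto simp: funpow_Suc_right shift_prepend_edge simp del: funpow.simps(2))
  qed auto
qed simp

lemma starts_with_prefix:
  assumes "starts_with u \<mu>" "starts_with v \<mu>" "length u \<le> length v"
  obtains w where "v = u @ w"
proof -
  have "u = map (\<lambda>i. fst (edge \<mu> i)) (take (length u) [0..<length v])"
    using assms by (simp add: starts_with_def)
  also have "\<dots> = take (length u) (map (\<lambda>i. fst (edge \<mu> i)) [0..<length v])"
    by (simp only: take_map)
  also have "\<dots> = take (length u) v" using assms(2) by (simp add: starts_with_def)
  finally show thesis using that append_take_drop_id by metis
qed

lemma starts_with_unique:
  "starts_with u \<mu> \<Longrightarrow> starts_with v \<mu> \<Longrightarrow> length u = length v \<Longrightarrow> u = v"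
  by (simp add: starts_with_def)

text \<open>Having at least \<open>k\<close> edges is expressed as having an initial word of length
  \<open>k\<close>, which ties powers of the shift to words. The recursion for
  \<open>shift_domain\<close> removes all vertices of the boundary, since every one of them is
  singular.\<close>

lemma shift_domain_eq: "shift_domain S k = {\<mu> \<in> boundary S. \<exists>w. length w = k \<and> starts_with w \<mu>}"
proof (induction k)
  case (Suc k)
  show ?case
  proof (rule Set.set_eqI)
    fix \<mu>
    show "\<mu> \<in> shift_domain S (Suc k)
        \<longleftrightarrow> \<mu> \<in> {\<mu> \<in> boundary S. \<exists>w. length w = Suc k \<and> starts_with w \<mu>}"
    proof (cases "\<mu> \<in> boundary S")
      case True
      then show ?thesis
      proof (cases rule: boundary_cases)
        case (edge e \<nu>)
        have "(\<exists>w. length w = Suc k \<and> starts_with w \<mu>) \<longleftrightarrow> (\<exists>w. length w = k \<and> starts_with w \<nu>)"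
          unfolding edge(1) by (metis length_Suc_conv starts_with_Cons_prepend_edge)
        then show ?thesis using True edge by (auto simp: Suc shift_prepend_edge)
      qed (auto simp: length_Suc_conv)
    qed auto
  qed
qed auto

text \<open>Identifies the vertex \<zeta> that \<open>move_path\<close> reads off the last removed
  edge, so that both cases of its definition become the range of the remaining path. Edges are
  numbered from 0, whence the index \<open>length w - 1\<close>.\<close>

lemma path_rng_after_word:
  assumes "\<mu> \<in> boundary S" "starts_with w \<mu>" "w \<noteq> []"
  shows "path_rng S ((shift ^^ length w) \<mu>) = dom_edge (edge \<mu> (length w - 1))"
  using assms
proof (induction w arbitrary: \<mu>)
  case (Cons a w)
  from Cons.prems(1,2) obtain \<eta> \<nu> where \<mu>: "\<mu> = prepend [(a, \<eta>)] \<nu>" "\<nu> \<in> boundary S"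
    "dom_edge (a, \<eta>) = path_rng S \<nu>" "shift \<mu> = \<nu>" "starts_with w \<nu>"
    by (rule starts_with_ConsE)
  show ?case
  proof (cases w)
    case Nil
    then show ?thesis using \<mu> by (simp add: edge_prepend_edge)
  next
    case (Cons b w')
    then have "edge \<mu> (length w) = edge \<nu> (length w - 1)"
      using \<mu> edge_prepend_edge(2)[of "length w'" \<nu>]
      by (simp add: starts_with_def) (meson Suc_ile_eq)
    then show ?thesis
      using Cons Cons.IH[of \<nu>] \<mu> by (simp add: funpow_Suc_right del: funpow.simps(2))
  qed
qed simp


section \<open>The partial action\<close>

context
  fixes S :: "('l, 'b::generalized_boolean_algebra) gbds"
  assumes gbds: "generalized_boolean_dynamical_system S"
begin

lemma label_ideal: "a \<in> labels S \<Longrightarrow> ba_ideal (ideal S a)"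
  using gbds by (simp add: generalized_boolean_dynamical_system_def)

lemma act_in_ideal: "a \<in> labels S \<Longrightarrow> act S a A \<in> ideal S a"
  using gbds by (auto simp: generalized_boolean_dynamical_system_def act_range_def)

text \<open>The preimage inherits the dichotomy because the action preserves \<open>inf\<close> and
  \<open>-\<close>. It can be empty, namely when no value of the action lies in \<eta>; this is the
  extra point of \<open>F0 S\<close>.\<close>

lemma pull_filter_ultrafilter:
  assumes "a \<in> labels S" "\<eta> \<in> ultrafilters_in (ideal S a)" "pull_filter S a \<eta> \<noteq> {}"
  shows "pull_filter S a \<eta> \<in> ultrafilters_in UNIV"
proof -
  have act: "act S a bot = bot" "act S a (inf A B) = inf (act S a A) (act S a B)"
    "act S a (A - B) = act S a A - act S a B" for A B
    using gbds assms(1) by (simp_all add: generalized_boolean_dynamical_system_def ba_action_def)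
  have \<eta>: "filter_in (ideal S a) \<eta>" "\<And>A B. A \<in> \<eta> \<Longrightarrow> inf A B \<in> \<eta> \<or> A - B \<in> \<eta>"
    using assms(2) by (simp_all add: ultrafilters_in_iff[OF label_ideal[OF assms(1)]])
  have mono: "act S a A \<le> act S a B" if "A \<le> B" for A B
    using that act(2)[of A B] by (simp add: inf.absorb1 le_iff_inf)
  have "filter_in UNIV (pull_filter S a \<eta>)"
    unfolding filter_in_def
  proof (intro conjI ballI impI)
    fix A B assume "A \<in> pull_filter S a \<eta>" "A \<le> B"
    then show "B \<in> pull_filter S a \<eta>"
      using filter_inD(4)[OF \<eta>(1) _ act_in_ideal[OF assms(1)] mono] by (simp add: pull_filter_def)
  qed (use assms(3) filter_inD(3,5)[OF \<eta>(1)] in \<open>simp_all add: pull_filter_def act\<close>)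
  moreover have "inf A B \<in> pull_filter S a \<eta> \<or> A - B \<in> pull_filter S a \<eta>"
    if "A \<in> pull_filter S a \<eta>" for A B
    using that \<eta>(2) unfolding pull_filter_def mem_Collect_eq act by blast
  ultimately show ?thesis unfolding ultrafilters_in_iff[OF ba_ideal_UNIV] by blast
qed

lemma path_rng_ultrafilter:
  assumes "\<mu> \<in> boundary S" "path_rng S \<mu> \<noteq> {}"
  shows "path_rng S \<mu> \<in> ultrafilters_in UNIV"
  using assms(1)
proof (cases rule: boundary_cases)
  case (vertex v)
  then show ?thesis by (simp add: E0_sg_def E0_def)
next
  case (edge e \<nu>)
  then show ?thesis
    using assms(2) pull_filter_ultrafilter[of "fst e" "snd e"] by (auto simp: rng_edge_def E1_def)
qed

text \<open>A value of the action of \<open>b\<close>, the first letter of \<open>w\<close>, lies in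
  \<open>ideal S b\<close>. So if \<open>B\<close> is a witness for \<open>a # w\<close>, then
  \<open>act S b B\<close> is one for \<open>w\<close>.\<close>

lemma ideal_word_subset:
  assumes "a # w \<in> lists (labels S)" "w \<noteq> []"
  shows "ideal_word S (a # w) \<subseteq> ideal_word S w"
proof
  fix A assume "A \<in> ideal_word S (a # w)"
  then obtain B where B: "A \<le> act_word S w B" by auto
  obtain b v where w: "w = b # v" using assms(2) by (cases w) auto
  have "act S b B \<in> ideal S b" using assms(1) w by (simp add: act_in_ideal)
  then show "A \<in> ideal_word S w" using B w by (auto simp: act_word_def)
qed

text \<open>For one edge \<open>(a, \<eta>)\<close>, membership of \<open>B\<close> in the range
  means that \<open>act S a B\<close> is in \<eta>, hence in its upward closure, which is the range
  of the rest of the path.\<close>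

lemma act_word_path_rng:
  assumes "\<mu> \<in> boundary S" "starts_with w \<mu>" "B \<in> path_rng S \<mu>"
  shows "act_word S w B \<in> path_rng S ((shift ^^ length w) \<mu>)"
  using assms
proof (induction w arbitrary: \<mu> B)
  case (Cons a w)
  from Cons.prems(1,2) obtain \<eta> \<nu> where \<mu>: "\<mu> = prepend [(a, \<eta>)] \<nu>" "\<nu> \<in> boundary S"
    "dom_edge (a, \<eta>) = path_rng S \<nu>" "shift \<mu> = \<nu>" "starts_with w \<nu>"
    by (rule starts_with_ConsE)
  have "act S a B \<in> \<eta>" using Cons.prems(3) \<mu>(1) by (simp add: rng_edge_def pull_filter_def)
  then have "act S a B \<in> path_rng S \<nu>" using \<mu>(3) by (auto simp: dom_edge_def)
  then have "act_word S w (act S a B) \<in> path_rng S ((shift ^^ length w) \<nu>)"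
    using Cons.IH \<mu> by blast
  then show ?case using \<mu>(4) by (simp add: act_word_def funpow_Suc_right del: funpow.simps(2))
qed (simp add: act_word_def)

text \<open>A member of the filter of the first edge lies in the ideal of the first letter; the
  remaining letters push it into both sets. This is the necessary condition for \<open>w\<close> to
  lead to the remaining path, and \<open>prepend_lift_edges\<close> is the converse.\<close>

lemma path_rng_meets_ideal_word:
  assumes "\<mu> \<in> boundary S" "starts_with w \<mu>" "w \<noteq> []"
  shows "path_rng S ((shift ^^ length w) \<mu>) \<inter> ideal_word S w \<noteq> {}"
proof -
  obtain a v where w: "w = a # v" using assms(3) by (cases w) auto
  from assms(1,2) obtain \<eta> \<nu> where \<mu>: "(a, \<eta>) \<in> E1 S" "\<nu> \<in> boundary S"
    "dom_edge (a, \<eta>) = path_rng S \<nu>" "shift \<mu> = \<nu>" "starts_with v \<nu>"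
    unfolding w by (rule starts_with_ConsE)
  have fil: "filter_in (ideal S a) \<eta>" using \<mu>(1) by (simp add: E1_def ultrafilter_imp_filter)
  obtain B where B: "B \<in> \<eta>" "B \<in> ideal S a"
    using filter_inD(1,2)[OF fil] by blast
  have "B \<in> path_rng S \<nu>" using B(1) unfolding \<mu>(3)[symmetric] dom_edge_def by auto
  then have "act_word S v B \<in> path_rng S ((shift ^^ length w) \<mu>)"
    using act_word_path_rng \<mu> w by (simp add: funpow_Suc_right del: funpow.simps(2))
  moreover have "act_word S v B \<in> ideal_word S w" using B w by auto
  ultimately show ?thesis by blast
qed

lemma starts_with_labels:
  assumes "\<mu> \<in> boundary S" "starts_with w \<mu>"
  shows "w \<in> lists (labels S)"
  using assms
proof (induction w arbitrary: \<mu>)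
  case (Cons a w)
  from Cons.prems obtain \<eta> \<nu> where "(a, \<eta>) \<in> E1 S" "\<nu> \<in> boundary S" "starts_with w \<nu>"
    by (rule starts_with_ConsE)
  then show ?case using Cons.IH by (auto simp: E1_def)
qed simp

text \<open>The range of the remaining path meets the ideal of \<open>w\<close> but, being a filter,
  omits \<open>bot\<close>, so the ideal has another element. For the empty word the algebra itself
  must be non-trivial; any ultrafilter occurring in the path contains an element other than
  \<open>bot\<close>.\<close>

lemma starts_with_Wstar:
  assumes "\<mu> \<in> boundary S" "starts_with w \<mu>"
  shows "w \<in> Wstar S"
proof -
  have "ideal_word S w \<noteq> {bot}"
  proof (cases "w = []")
    case True
    obtain J :: "'b set" and \<eta> where "\<eta> \<in> ultrafilters_in J"
      using assms(1) by (cases rule: boundary_cases) (auto simp: E0_sg_def E0_def E1_def)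
    then have fil: "filter_in J \<eta>" by (rule ultrafilter_imp_filter)
    then obtain A where "A \<in> \<eta>" using filter_inD(2) by blast
    then have "A \<noteq> (bot::'b)" using filter_inD(3)[OF fil] by blast
    then have "(UNIV::'b set) \<noteq> {bot}" by auto
    then show ?thesis using True by simp
  next
    case False
    have b: "(shift ^^ length w) \<mu> \<in> boundary S" by (rule funpow_shift_boundary[OF assms])
    have "bot \<notin> path_rng S ((shift ^^ length w) \<mu>)"
      using filter_inD(3)[OF ultrafilter_imp_filter[OF path_rng_ultrafilter[OF b]]] by blast
    then show ?thesis using path_rng_meets_ideal_word[OF assms False] by auto
  qed
  then show ?thesis using starts_with_labels[OF assms] by (simp add: Wstar_def)
qed

text \<open>By induction the paths agree after their first edges. These edges then have the same
  label \<open>a\<close> and the same domain, and intersecting the domain with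
  \<open>ideal S a\<close> gives back their filters.\<close>

lemma shift_inj_starts_with:
  assumes "\<mu> \<in> boundary S" "\<mu>' \<in> boundary S" "starts_with w \<mu>" "starts_with w \<mu>'"
    and "(shift ^^ length w) \<mu> = (shift ^^ length w) \<mu>'"
  shows "\<mu> = \<mu>'"
  using assms
proof (induction w arbitrary: \<mu> \<mu>')
  case (Cons a w)
  from Cons.prems(1,3) obtain \<eta> \<nu> where \<mu>: "\<mu> = prepend [(a, \<eta>)] \<nu>" "(a, \<eta>) \<in> E1 S"
    "\<nu> \<in> boundary S" "dom_edge (a, \<eta>) = path_rng S \<nu>" "shift \<mu> = \<nu>" "starts_with w \<nu>"
    by (rule starts_with_ConsE)
  from Cons.prems(2,4) obtain \<eta>' \<nu>' where \<mu>': "\<mu>' = prepend [(a, \<eta>')] \<nu>'" "(a, \<eta>') \<in> E1 S"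
    "\<nu>' \<in> boundary S" "dom_edge (a, \<eta>') = path_rng S \<nu>'" "shift \<mu>' = \<nu>'" "starts_with w \<nu>'"
    by (rule starts_with_ConsE)
  have \<nu>: "\<nu> = \<nu>'"
    using Cons.IH[of \<nu> \<nu>'] Cons.prems(5) \<mu> \<mu>' by (simp add: funpow_Suc_right del: funpow.simps(2))
  have "filter_in (ideal S a) \<eta>" "filter_in (ideal S a) \<eta>'"
    using \<mu>(2) \<mu>'(2) by (auto simp: E1_def intro: ultrafilter_imp_filter)
  then have "\<eta> = \<eta>'"
    using dom_edge_Int_ideal[of "ideal S a"] \<mu>(4) \<mu>'(4) \<nu> by metis
  then show ?case using \<mu>(1) \<mu>'(1) \<nu> by simp
qed simp

section \<open>Lifts of words: existence and uniqueness\<close>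

lemma prepend_restrict_boundary:
  assumes "\<nu> \<in> boundary S" "a \<in> labels S" "path_rng S \<nu> \<inter> ideal S a \<noteq> {}"
  defines "e \<equiv> (a, path_rng S \<nu> \<inter> ideal S a)"
  shows "prepend [e] \<nu> \<in> boundary S" "shift (prepend [e] \<nu>) = \<nu>"
proof -
  have uf: "path_rng S \<nu> \<in> ultrafilters_in UNIV" using path_rng_ultrafilter assms by blast
  have e: "e \<in> E1 S" "dom_edge e = path_rng S \<nu>"
    using ultrafilter_restrict[OF uf label_ideal] dom_edge_restrict[OF uf label_ideal] assms(2,3)
    by (simp_all add: E1_def e_def)
  show "prepend [e] \<nu> \<in> boundary S" "shift (prepend [e] \<nu>) = \<nu>"
    using e assms(1) by (simp_all add: prepend_edge_boundary shift_prepend_edge)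
qed

text \<open>The recursion of \<open>lift_edges\<close> inspects the head of the list built so far.
  Here that head is replaced by the range of the path built so far, which suits an induction putting
  one edge at a time in front.\<close>

lemma lift_edges_Cons:
  assumes "w \<noteq> []"
  shows "lift_edges S (a # w) (path_rng S \<nu>)
    = (a, path_rng S (prepend (lift_edges S w (path_rng S \<nu>)) \<nu>) \<inter> ideal S a)
        # lift_edges S w (path_rng S \<nu>)"
proof -
  obtain b v where w: "w = b # v" using assms by (cases w) auto
  obtain \<eta> es where "lift_edges S w (path_rng S \<nu>) = (b, \<eta>) # es"
    using w by (cases v) (auto simp: Let_def)
  then show ?thesis
    using w prepend_Cons[of "(b, \<eta>)" es \<nu>] by (simp add: rng_edge_def)
qed

text \<open>The last clause is what keeps the induction going: it pulls elements of the range of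
  \<nu> back along the word, and thereby shows that the filter of the next edge is
  non-empty.\<close>

lemma prepend_lift_edges:
  assumes "\<nu> \<in> boundary S" "w \<in> lists (labels S)" "w \<noteq> []"
    and "path_rng S \<nu> \<inter> ideal_word S w \<noteq> {}"
  defines "\<mu> \<equiv> prepend (lift_edges S w (path_rng S \<nu>)) \<nu>"
  shows "\<mu> \<in> boundary S \<and> starts_with w \<mu> \<and> (shift ^^ length w) \<mu> = \<nu>
    \<and> (\<forall>B. act_word S w B \<in> path_rng S \<nu> \<longrightarrow> B \<in> path_rng S \<mu>)"
  using assms(2-4) unfolding \<mu>_def
proof (induction w rule: list.induct)
  case (Cons a w)
  define \<mu>' where "\<mu>' = prepend (lift_edges S w (path_rng S \<nu>)) \<nu>"
  have \<mu>': "\<mu>' \<in> boundary S" "starts_with w \<mu>'" "(shift ^^ length w) \<mu>' = \<nu>"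
    and pull: "\<And>B. act_word S w B \<in> path_rng S \<nu> \<Longrightarrow> B \<in> path_rng S \<mu>'"
  proof -
    have "\<mu>' \<in> boundary S \<and> starts_with w \<mu>' \<and> (shift ^^ length w) \<mu>' = \<nu>
      \<and> (\<forall>B. act_word S w B \<in> path_rng S \<nu> \<longrightarrow> B \<in> path_rng S \<mu>')"
    proof (cases "w = []")
      case True
      then show ?thesis using assms(1) by (simp add: \<mu>'_def act_word_def)
    next
      case False
      then show ?thesis
        using Cons.IH Cons.prems ideal_word_subset[OF Cons.prems(1) False] unfolding \<mu>'_def by auto
    qed
    then show "\<mu>' \<in> boundary S" "starts_with w \<mu>'" "(shift ^^ length w) \<mu>' = \<nu>"
      "\<And>B. act_word S w B \<in> path_rng S \<nu> \<Longrightarrow> B \<in> path_rng S \<mu>'" by blast+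
  qed
  have \<mu>: "prepend (lift_edges S (a # w) (path_rng S \<nu>)) \<nu>
      = prepend [(a, path_rng S \<mu>' \<inter> ideal S a)] \<mu>'"
  proof (cases "w = []")
    case False
    show ?thesis
      unfolding lift_edges_Cons[OF False] \<mu>'_def by (rule prepend_Cons)
  qed (simp add: \<mu>'_def)
  \<comment> \<open>\<open>B\<close> comes from the definition of \<open>ideal_word\<close>. Since
    \<open>act_word S w B\<close> lies above \<open>A\<close>, it is in the range of \<nu>, and
    pulling it back puts \<open>B\<close> into both the range of \<open>\<mu>'\<close> and
    \<open>ideal S a\<close>.\<close>
  obtain A B where B: "A \<in> path_rng S \<nu>" "B \<in> ideal S a" "A \<le> act_word S w B"
    using Cons.prems(3) by auto
  have "filter_in UNIV (path_rng S \<nu>)"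
    using path_rng_ultrafilter[OF assms(1)] B(1) by (blast intro: ultrafilter_imp_filter)
  then have "act_word S w B \<in> path_rng S \<nu>" using filter_inD(4) B by blast
  then have ne: "path_rng S \<mu>' \<inter> ideal S a \<noteq> {}" using pull B(2) by blast
  have a: "a \<in> labels S" using Cons.prems(1) by simp
  have "C \<in> path_rng S (prepend [(a, path_rng S \<mu>' \<inter> ideal S a)] \<mu>')"
    if "act_word S (a # w) C \<in> path_rng S \<nu>" for C
    using that pull[of "act S a C"] act_in_ideal[OF a]
    by (simp add: act_word_def rng_edge_def pull_filter_def)
  then show ?case
    using prepend_restrict_boundary[OF \<mu>'(1) a ne] \<mu>'(2,3) unfolding \<mu>
    by (simp add: funpow_Suc_right del: funpow.simps(2))
qed simp

text \<open>The lifted path and \<mu> start with the same word and leave the same remaining path, so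
  \<open>shift_inj_starts_with\<close> identifies them.\<close>

lemma prepend_lift_edges_unique:
  assumes "\<mu> \<in> boundary S" "starts_with w \<mu>" "(shift ^^ length w) \<mu> = \<nu>"
  shows "prepend (lift_edges S w (path_rng S \<nu>)) \<nu> = \<mu>"
proof (cases "w = []")
  case False
  have "prepend (lift_edges S w (path_rng S \<nu>)) \<nu> \<in> boundary S
      \<and> starts_with w (prepend (lift_edges S w (path_rng S \<nu>)) \<nu>)
      \<and> (shift ^^ length w) (prepend (lift_edges S w (path_rng S \<nu>)) \<nu>) = \<nu>"
    using prepend_lift_edges[of \<nu> w] False assms starts_with_labels[OF assms(1,2)]
      path_rng_meets_ideal_word[OF assms(1,2) False] funpow_shift_boundary[OF assms(1,2)] by simp
  then show ?thesis using shift_inj_starts_with assms by metis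
qed (use assms in simp)

lemma Wstar_labels: "w \<in> Wstar S \<Longrightarrow> w \<in> lists (labels S)"
  by (simp add: Wstar_def)

section \<open>Domains and maps of the partial action in terms of words\<close>

lemma move_path_eq:
  assumes "\<nu> \<in> boundary S" "starts_with \<beta> \<nu>" "(shift ^^ length \<beta>) \<nu> = \<rho>"
  shows "move_path S \<alpha> \<beta> \<nu> = prepend (lift_edges S \<alpha> (path_rng S \<rho>)) \<rho>"
  using path_rng_after_word[OF assms(1,2)] assms(3) by (auto simp: move_path_def)

text \<open>The range of the remaining path is the upward closure of the filter of the last removed
  edge, and the ideal of a word is closed downwards, so meeting it is the same for both.\<close>

lemma edge_meets_ideal_word_iff:
  assumes "\<mu> \<in> boundary S" "starts_with \<alpha> \<mu>" "\<alpha> \<noteq> []" "\<beta> \<noteq> []"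
  shows "snd (edge \<mu> (length \<alpha> - 1)) \<inter> ideal_word S \<beta> \<noteq> {}
    \<longleftrightarrow> path_rng S ((shift ^^ length \<alpha>) \<mu>) \<inter> ideal_word S \<beta> \<noteq> {}"
proof -
  obtain b w where "\<beta> = b # w" using assms(4) by (cases \<beta>) auto
  then have "A \<in> ideal_word S \<beta>" if "B \<in> ideal_word S \<beta>" "A \<le> B" for A B
    using that by (auto intro: order_trans)
  then show ?thesis
    unfolding path_rng_after_word[OF assms(1-3)] by (fastforce simp: dom_edge_def)
qed

text \<open>Merges the four alternatives of \<open>U_set\<close> into one, with empty words allowed.
  The proviso \<open>\<beta> \<noteq> []\<close> is essential: for empty \<beta> the intersection
  with \<open>UNIV\<close> would demand a non-empty range, which can fail when \<alpha> is empty as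
  well.\<close>

lemma U_set_iff:
  "\<nu> \<in> U_set S t \<longleftrightarrow> \<nu> \<in> boundary S \<and> (\<exists>\<alpha>\<in>Wstar S. \<exists>\<beta>\<in>Wstar S. reduced_form \<alpha> \<beta>
     \<and> t = quot_word (labels S) \<alpha> \<beta> \<and> starts_with \<alpha> \<nu>
     \<and> (\<beta> \<noteq> [] \<longrightarrow> path_rng S ((shift ^^ length \<alpha>) \<nu>) \<inter> ideal_word S \<beta> \<noteq> {}))"
  (is "_ \<longleftrightarrow> _ \<and> ?R")
proof (cases "\<nu> \<in> boundary S")
  case True
  have Wpos: "\<alpha> \<in> Wpos S \<longleftrightarrow> \<alpha> \<in> Wstar S \<and> \<alpha> \<noteq> []" for \<alpha>
    by (cases \<alpha>) (auto simp: Wpos_def)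
  have Nil: "[] \<in> Wstar S" using starts_with_Wstar[OF True, of "[]"] by simp
  have one: "quot_word (labels S) [] [] = \<one>\<^bsub>free_group (labels S)\<^esub>"
    by (simp add: quot_word_Nil free_gen_word_def free_group_def)
  have "?R \<longleftrightarrow>
    (\<exists>\<alpha>\<in>Wstar S. \<exists>\<beta>\<in>Wstar S. \<alpha> = [] \<and> \<beta> = [] \<and> t = \<one>\<^bsub>free_group (labels S)\<^esub>)
    \<or> (\<exists>\<alpha>\<in>Wpos S. \<exists>\<beta>\<in>Wpos S. reduced_form \<alpha> \<beta> \<and> t = quot_word (labels S) \<alpha> \<beta>
          \<and> starts_with \<alpha> \<nu> \<and> path_rng S ((shift ^^ length \<alpha>) \<nu>) \<inter> ideal_word S \<beta> \<noteq> {})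
    \<or> (\<exists>\<alpha>\<in>Wpos S. t = free_gen_word \<alpha> \<and> starts_with \<alpha> \<nu>)
    \<or> (\<exists>\<beta>\<in>Wpos S. t = inv\<^bsub>free_group (labels S)\<^esub> (free_gen_word \<beta>)
          \<and> path_rng S \<nu> \<inter> ideal_word S \<beta> \<noteq> {})" (is "_ \<longleftrightarrow> ?R'")
  proof
    assume ?R
    then obtain \<alpha> \<beta> where *: "\<alpha> \<in> Wstar S" "\<beta> \<in> Wstar S" "reduced_form \<alpha> \<beta>"
      "t = quot_word (labels S) \<alpha> \<beta>" "starts_with \<alpha> \<nu>"
      "\<beta> \<noteq> [] \<longrightarrow> path_rng S ((shift ^^ length \<alpha>) \<nu>) \<inter> ideal_word S \<beta> \<noteq> {}" by blast
    show ?R'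
    proof (cases "\<alpha> = []"; cases "\<beta> = []")
      assume "\<alpha> = []" "\<beta> = []"
      then show ?R' using * one by auto
    next
      assume "\<alpha> = []" "\<beta> \<noteq> []"
      then have "\<beta> \<in> Wpos S" "t = inv\<^bsub>free_group (labels S)\<^esub> (free_gen_word \<beta>)"
        "path_rng S \<nu> \<inter> ideal_word S \<beta> \<noteq> {}"
        using * quot_word_Nil(2)[OF Wstar_labels] by (simp_all add: Wpos)
      then show ?R' by blast
    next
      assume "\<alpha> \<noteq> []" "\<beta> = []"
      then have "\<alpha> \<in> Wpos S" "t = free_gen_word \<alpha>"
        using * quot_word_Nil(1)[OF Wstar_labels] by (simp_all add: Wpos)
      then show ?R' using *(5) by blast
    next
      assume "\<alpha> \<noteq> []" "\<beta> \<noteq> []"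
      then have "\<alpha> \<in> Wpos S" "\<beta> \<in> Wpos S" using * by (simp_all add: Wpos)
      then show ?R' using * \<open>\<beta> \<noteq> []\<close> by blast
    qed
  next
    assume ?R'
    then show ?R
    proof (elim disjE bexE conjE)
      assume "t = \<one>\<^bsub>free_group (labels S)\<^esub>"
      then show ?thesis
        using Nil one by (intro bexI[of _ "[]"]) (simp_all add: reduced_form_iff)
    next
      fix \<alpha> \<beta>
      assume "\<alpha> \<in> Wpos S" "\<beta> \<in> Wpos S" "reduced_form \<alpha> \<beta>" "t = quot_word (labels S) \<alpha> \<beta>"
        "starts_with \<alpha> \<nu>" "path_rng S ((shift ^^ length \<alpha>) \<nu>) \<inter> ideal_word S \<beta> \<noteq> {}"
      then show ?thesis unfolding Wpos by blast
    next
      fix \<alpha> assume "\<alpha> \<in> Wpos S" "t = free_gen_word \<alpha>" "starts_with \<alpha> \<nu>"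
      then show ?thesis
        using Nil quot_word_Nil(1)[OF Wstar_labels]
        by (intro bexI[of _ \<alpha>] bexI[of _ "[]"]) (simp_all add: reduced_form_iff Wpos)
    next
      fix \<beta> assume "\<beta> \<in> Wpos S" "t = inv\<^bsub>free_group (labels S)\<^esub> (free_gen_word \<beta>)"
        "path_rng S \<nu> \<inter> ideal_word S \<beta> \<noteq> {}"
      then show ?thesis
        using Nil quot_word_Nil(2)[OF Wstar_labels]
        by (intro bexI[of _ "[]"] bexI[of _ \<beta>]) (simp_all add: reduced_form_iff Wpos)
    qed
  qed
  moreover have "(\<exists>\<alpha>\<in>Wstar S. \<exists>\<beta>\<in>Wstar S. \<alpha> = [] \<and> \<beta> = [] \<and> t = \<one>\<^bsub>free_group (labels S)\<^esub>)
      \<longleftrightarrow> t = \<one>\<^bsub>free_group (labels S)\<^esub>" using Nil by blast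
  moreover have "(\<exists>\<alpha>\<in>Wpos S. \<exists>\<beta>\<in>Wpos S. reduced_form \<alpha> \<beta> \<and> t = quot_word (labels S) \<alpha> \<beta>
        \<and> starts_with \<alpha> \<nu> \<and> path_rng S ((shift ^^ length \<alpha>) \<nu>) \<inter> ideal_word S \<beta> \<noteq> {})
    \<longleftrightarrow> (\<exists>\<alpha>\<in>Wpos S. \<exists>\<beta>\<in>Wpos S. reduced_form \<alpha> \<beta> \<and> t = quot_word (labels S) \<alpha> \<beta>
        \<and> starts_with \<alpha> \<nu> \<and> snd (edge \<nu> (length \<alpha> - 1)) \<inter> ideal_word S \<beta> \<noteq> {})"
    using edge_meets_ideal_word_iff[OF True] by (intro bex_cong refl conj_cong) (simp add: Wpos)
  ultimately show ?thesis using True by (simp only: U_set_def mem_Collect_eq simp_thms)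
qed (simp add: U_set_def)

text \<open>Uniqueness of the reduced form makes the description in \<open>phi\<close>
  definite.\<close>

lemma phi_quot_word:
  assumes "\<alpha> \<in> Wstar S" "\<beta> \<in> Wstar S" "reduced_form \<alpha> \<beta>"
  shows "phi S (quot_word (labels S) \<alpha> \<beta>) \<nu> = move_path S \<alpha> \<beta> \<nu>"
  unfolding phi_def
proof (rule the_equality)
  fix \<mu>
  assume "\<exists>\<alpha>'\<in>Wstar S. \<exists>\<beta>'\<in>Wstar S. reduced_form \<alpha>' \<beta>'
    \<and> quot_word (labels S) \<alpha> \<beta> = quot_word (labels S) \<alpha>' \<beta>' \<and> \<mu> = move_path S \<alpha>' \<beta>' \<nu>"
  then show "\<mu> = move_path S \<alpha> \<beta> \<nu>"
    using quot_word_reduced_inj[OF Wstar_labels Wstar_labels] assms by metis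
qed (use assms in blast)

end

section \<open>Tail equality and the arrows of the two groupoids\<close>

definition tail_equal :: "('l, 'b::generalized_boolean_algebra) gbds \<Rightarrow> 'l list \<Rightarrow> 'l list
    \<Rightarrow> ('l, 'b) bpath \<Rightarrow> ('l, 'b) bpath \<Rightarrow> bool" where
  "tail_equal S \<alpha> \<beta> \<mu> \<nu> \<longleftrightarrow> \<mu> \<in> boundary S \<and> \<nu> \<in> boundary S \<and> starts_with \<alpha> \<mu> \<and> starts_with \<beta> \<nu>
     \<and> (shift ^^ length \<alpha>) \<mu> = (shift ^^ length \<beta>) \<nu>"

lemma tail_equal_sym: "tail_equal S \<alpha> \<beta> \<mu> \<nu> \<Longrightarrow> tail_equal S \<beta> \<alpha> \<nu> \<mu>"
  by (auto simp: tail_equal_def)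

lemma tail_equal_trans:
  "tail_equal S \<alpha> \<beta> \<mu> \<nu> \<Longrightarrow> tail_equal S \<beta> \<gamma> \<nu> \<delta> \<Longrightarrow> tail_equal S \<alpha> \<gamma> \<mu> \<delta>"
  by (auto simp: tail_equal_def)

context
  fixes S :: "('l, 'b::generalized_boolean_algebra) gbds"
  assumes gbds: "generalized_boolean_dynamical_system S"
begin

lemma tail_equal_words:
  assumes "tail_equal S \<alpha> \<beta> \<mu> \<nu>"
  shows "\<alpha> \<in> Wstar S" "\<beta> \<in> Wstar S" "\<alpha> \<in> lists (labels S)" "\<beta> \<in> lists (labels S)"
  using assms starts_with_Wstar[OF gbds] starts_with_labels[OF gbds] unfolding tail_equal_def by blast+

text \<open>Removing the suffix is injectivity of the shift on the paths that start with \<gamma>.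
  For adding it, a condition on the \<mu> side is enough because the two remaining paths
  coincide.\<close>

lemma tail_equal_append:
  "tail_equal S (\<alpha> @ \<gamma>) (\<beta> @ \<gamma>) \<mu> \<nu>
    \<longleftrightarrow> tail_equal S \<alpha> \<beta> \<mu> \<nu> \<and> starts_with \<gamma> ((shift ^^ length \<alpha>) \<mu>)"
proof (cases "\<mu> \<in> boundary S \<and> \<nu> \<in> boundary S \<and> starts_with \<alpha> \<mu> \<and> starts_with \<beta> \<nu>")
  case True
  have add: "(shift ^^ (length \<alpha> + length \<gamma>)) \<mu> = (shift ^^ length \<gamma>) ((shift ^^ length \<alpha>) \<mu>)"
    "(shift ^^ (length \<beta> + length \<gamma>)) \<nu> = (shift ^^ length \<gamma>) ((shift ^^ length \<beta>) \<nu>)"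
    by (metis add.commute comp_apply funpow_add)+
  have bd: "(shift ^^ length \<alpha>) \<mu> \<in> boundary S" "(shift ^^ length \<beta>) \<nu> \<in> boundary S"
    using True funpow_shift_boundary by blast+
  have "starts_with \<gamma> ((shift ^^ length \<alpha>) \<mu>) \<Longrightarrow> starts_with \<gamma> ((shift ^^ length \<beta>) \<nu>)
    \<Longrightarrow> (shift ^^ length \<gamma>) ((shift ^^ length \<alpha>) \<mu>) = (shift ^^ length \<gamma>) ((shift ^^ length \<beta>) \<nu>)
    \<Longrightarrow> (shift ^^ length \<alpha>) \<mu> = (shift ^^ length \<beta>) \<nu>"
    using shift_inj_starts_with[OF gbds bd] .
  then show ?thesis
    using True by (auto simp: tail_equal_def starts_with_append add)
qed (auto simp: tail_equal_def starts_with_append)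

text \<open>The condition describing the domain of \<open>phi S t\<close> is the hypothesis of
  \<open>prepend_lift_edges\<close>, so \<mu> is the lift of \<alpha> to what remains of \<nu> after
  \<beta>.\<close>

lemma transformation_arrowE:
  assumes "(\<mu>, t, \<nu>) \<in> transformation_arrows S"
  obtains \<alpha> \<beta> where "t = quot_word (labels S) \<alpha> \<beta>" "tail_equal S \<alpha> \<beta> \<mu> \<nu>" "reduced_form \<alpha> \<beta>"
proof -
  interpret group "free_group (labels S)" by (rule group_free_group)
  have t: "t \<in> carrier (free_group (labels S))" "\<nu> \<in> U_set S (inv\<^bsub>free_group (labels S)\<^esub> t)"
    "\<mu> = phi S t \<nu>"
    using assms by (auto simp: transformation_arrows_def)
  \<comment> \<open>The domain belongs to the inverse of \<open>t\<close>, so the two words appear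
    exchanged here.\<close>
  then obtain \<alpha> \<beta> where *: "\<nu> \<in> boundary S" "\<alpha> \<in> Wstar S" "\<beta> \<in> Wstar S" "reduced_form \<alpha> \<beta>"
      "inv\<^bsub>free_group (labels S)\<^esub> t = quot_word (labels S) \<beta> \<alpha>" "starts_with \<beta> \<nu>"
      "\<alpha> \<noteq> [] \<longrightarrow> path_rng S ((shift ^^ length \<beta>) \<nu>) \<inter> ideal_word S \<alpha> \<noteq> {}"
    unfolding U_set_iff[OF gbds] using reduced_form_sym by metis
  have lists: "\<alpha> \<in> lists (labels S)" "\<beta> \<in> lists (labels S)" using * Wstar_labels[OF gbds] by blast+
  have tq: "t = quot_word (labels S) \<alpha> \<beta>"
    using t(1) *(5) inv_quot_word[OF lists(2,1)] inv_inv by metis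
  define \<rho> where "\<rho> = (shift ^^ length \<beta>) \<nu>"
  have \<rho>: "\<rho> \<in> boundary S" using *(1,6) by (simp add: \<rho>_def funpow_shift_boundary)
  have \<mu>: "\<mu> = prepend (lift_edges S \<alpha> (path_rng S \<rho>)) \<rho>"
    using t(3) tq phi_quot_word[OF gbds *(2-4)] move_path_eq[OF gbds *(1,6) \<rho>_def[symmetric]] by simp
  have "\<mu> \<in> boundary S \<and> starts_with \<alpha> \<mu> \<and> (shift ^^ length \<alpha>) \<mu> = \<rho>"
  proof (cases "\<alpha> = []")
    case False
    then show ?thesis
      using prepend_lift_edges[OF gbds \<rho> lists(1) False] *(7) unfolding \<mu> \<rho>_def by blast
  qed (use \<mu> \<rho> in simp)
  then have "tail_equal S \<alpha> \<beta> \<mu> \<nu>" using *(1,6) by (simp add: tail_equal_def \<rho>_def)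
  then show thesis using that tq *(4) by blast
qed

text \<open>From right to left, the common suffix is stripped first, since \<open>phi\<close> is
  described through reduced forms. Then \<mu> must be the lift that defines
  \<open>phi S t \<nu>\<close>, because lifts are unique.\<close>

lemma transformation_arrows_iff:
  "(\<mu>, t, \<nu>) \<in> transformation_arrows S
    \<longleftrightarrow> (\<exists>\<alpha> \<beta>. t = quot_word (labels S) \<alpha> \<beta> \<and> tail_equal S \<alpha> \<beta> \<mu> \<nu>)"
proof
  assume "\<exists>\<alpha> \<beta>. t = quot_word (labels S) \<alpha> \<beta> \<and> tail_equal S \<alpha> \<beta> \<mu> \<nu>"
  then obtain \<alpha>' \<beta>' where "t = quot_word (labels S) \<alpha>' \<beta>'" and eq': "tail_equal S \<alpha>' \<beta>' \<mu> \<nu>"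
    by blast
  then obtain \<alpha> \<beta> \<gamma> where "\<alpha>' = \<alpha> @ \<gamma>" "\<beta>' = \<beta> @ \<gamma>" and red: "reduced_form \<alpha> \<beta>"
    and t: "t = quot_word (labels S) \<alpha> \<beta>"
    using quot_word_reduced_form[OF tail_equal_words(3,4)[OF eq']] by metis
  then have eq: "tail_equal S \<alpha> \<beta> \<mu> \<nu>" using eq' tail_equal_append by simp
  note words = tail_equal_words[OF eq]
  from eq have *: "\<mu> \<in> boundary S" "\<nu> \<in> boundary S" "starts_with \<alpha> \<mu>" "starts_with \<beta> \<nu>"
    "(shift ^^ length \<alpha>) \<mu> = (shift ^^ length \<beta>) \<nu>" by (simp_all add: tail_equal_def)
  have "\<nu> \<in> U_set S (inv\<^bsub>free_group (labels S)\<^esub> t)"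
    unfolding U_set_iff[OF gbds] t inv_quot_word[OF words(3,4)]
    using * words red reduced_form_sym path_rng_meets_ideal_word[OF gbds *(1,3)] by metis
  moreover have "\<mu> = phi S t \<nu>"
    using prepend_lift_edges_unique[OF gbds *(1,3,5)] move_path_eq[OF gbds *(2,4) refl]
      phi_quot_word[OF gbds words(1,2) red] t by simp
  ultimately show "(\<mu>, t, \<nu>) \<in> transformation_arrows S"
    using * t words by (simp add: transformation_arrows_def)
qed (blast elim: transformation_arrowE)

text \<open>The arrow is known to be a tail equality only along the reduced form of
  \<open>t\<close>. By uniqueness of that form, \<alpha> and \<beta> extend it by a common suffix,
  and \<mu> continues with this suffix because it starts with \<alpha>.\<close>

lemma tail_equal_quot_word:
  assumes "(\<mu>, quot_word (labels S) \<alpha> \<beta>, \<nu>) \<in> transformation_arrows S"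
    and "starts_with \<alpha> \<mu>" "starts_with \<beta> \<nu>"
  shows "tail_equal S \<alpha> \<beta> \<mu> \<nu>"
proof -
  obtain \<alpha>' \<beta>' where *: "quot_word (labels S) \<alpha> \<beta> = quot_word (labels S) \<alpha>' \<beta>'"
    "tail_equal S \<alpha>' \<beta>' \<mu> \<nu>" "reduced_form \<alpha>' \<beta>'"
    using assms(1) by (rule transformation_arrowE)
  then have bd: "\<mu> \<in> boundary S" "\<nu> \<in> boundary S" by (simp_all add: tail_equal_def)
  obtain \<alpha>0 \<beta>0 \<gamma> where 0: "\<alpha> = \<alpha>0 @ \<gamma>" "\<beta> = \<beta>0 @ \<gamma>" "reduced_form \<alpha>0 \<beta>0"
    "quot_word (labels S) \<alpha> \<beta> = quot_word (labels S) \<alpha>0 \<beta>0"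
    using quot_word_reduced_form starts_with_labels[OF gbds bd(1) assms(2)]
      starts_with_labels[OF gbds bd(2) assms(3)] by metis
  have "\<beta>0 \<in> lists (labels S)" using 0(2) starts_with_labels[OF gbds bd(2) assms(3)] by simp
  then have "\<alpha>0 = \<alpha>'" "\<beta>0 = \<beta>'"
    using quot_word_reduced_inj[OF _ tail_equal_words(4)[OF *(2)] 0(3) *(3)] 0(4) *(1) by simp_all
  then show ?thesis
    using *(2) assms(2) bd(1) 0 by (simp add: tail_equal_append starts_with_append)
qed

text \<open>Both arrows attach an initial word to \<nu>, and one of these words extends the other.
  Lengthening the other pair by the missing letters makes the middle words equal; they then cancel
  in the product.\<close>

lemma transformation_arrows_mult:
  assumes "(\<mu>, t, \<nu>) \<in> transformation_arrows S" "(\<nu>, s, \<delta>) \<in> transformation_arrows S"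
  shows "(\<mu>, t \<otimes>\<^bsub>free_group (labels S)\<^esub> s, \<delta>) \<in> transformation_arrows S"
proof -
  have common: "(\<mu>, t \<otimes>\<^bsub>free_group (labels S)\<^esub> s, \<delta>) \<in> transformation_arrows S"
    if "t = quot_word (labels S) \<alpha> \<beta>" "tail_equal S \<alpha> \<beta> \<mu> \<nu>"
      "s = quot_word (labels S) \<beta> \<gamma>" "tail_equal S \<beta> \<gamma> \<nu> \<delta>" for \<alpha> \<beta> \<gamma>
    unfolding transformation_arrows_iff
    using that tail_equal_trans[OF that(2,4)] tail_equal_words(3,4) quot_word_mult by metis
  obtain \<alpha> \<beta> where t: "t = quot_word (labels S) \<alpha> \<beta>" "tail_equal S \<alpha> \<beta> \<mu> \<nu>"
    using assms(1) by (rule transformation_arrowE)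
  obtain \<gamma> \<kappa> where s: "s = quot_word (labels S) \<gamma> \<kappa>" "tail_equal S \<gamma> \<kappa> \<nu> \<delta>"
    using assms(2) by (rule transformation_arrowE)
  have st: "starts_with \<beta> \<nu>" "starts_with \<gamma> \<nu>" "\<nu> \<in> boundary S" using t s by (simp_all add: tail_equal_def)
  show ?thesis
  proof (cases "length \<beta> \<le> length \<gamma>")
    case True
    then obtain \<epsilon> where \<epsilon>: "\<gamma> = \<beta> @ \<epsilon>" using starts_with_prefix[OF st(1,2)] by blast
    have "starts_with \<epsilon> ((shift ^^ length \<alpha>) \<mu>)"
      using t(2) st by (auto simp: \<epsilon> starts_with_append tail_equal_def)
    then have "tail_equal S (\<alpha> @ \<epsilon>) \<gamma> \<mu> \<nu>"
      unfolding \<epsilon> tail_equal_append using t(2) by blast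
    moreover have "t = quot_word (labels S) (\<alpha> @ \<epsilon>) \<gamma>"
      using quot_word_append[of \<alpha> "labels S" \<beta> \<epsilon>] t(1) \<epsilon> tail_equal_words(3,4)[OF t(2)]
        tail_equal_words(3)[OF s(2)] by simp
    ultimately show ?thesis using common s by blast
  next
    case False
    then obtain \<epsilon> where \<epsilon>: "\<beta> = \<gamma> @ \<epsilon>" using starts_with_prefix[OF st(2,1)] by (metis nat_le_linear)
    then have "tail_equal S \<beta> (\<kappa> @ \<epsilon>) \<nu> \<delta>"
      using s(2) st by (auto simp: tail_equal_append starts_with_append)
    moreover have "s = quot_word (labels S) \<beta> (\<kappa> @ \<epsilon>)"
      using quot_word_append[of \<gamma> "labels S" \<kappa> \<epsilon>] s(1) \<epsilon> tail_equal_words(3,4)[OF s(2)]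
        tail_equal_words(4)[OF t(2)] by simp
    ultimately show ?thesis using common t by blast
  qed
qed

lemma transformation_arrows_inv:
  "(\<mu>, t, \<nu>) \<in> transformation_arrows S
    \<Longrightarrow> (\<nu>, inv\<^bsub>free_group (labels S)\<^esub> t, \<mu>) \<in> transformation_arrows S"
  unfolding transformation_arrows_iff
  using tail_equal_sym inv_quot_word tail_equal_words(3,4) by metis

lemma shift_arrows_iff:
  "(\<mu>, n, \<nu>) \<in> shift_arrows S
    \<longleftrightarrow> (\<exists>\<alpha> \<beta>. n = int (length \<alpha>) - int (length \<beta>) \<and> tail_equal S \<alpha> \<beta> \<mu> \<nu>)"
  unfolding shift_arrows_def shift_domain_eq tail_equal_def by blast

text \<open>The description in \<open>Theta\<close> is definite because any two ways of writing
  \<open>t\<close> as such a quotient have the same degree.\<close>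

lemma Theta_quot_word:
  assumes "\<alpha> \<in> Wstar S" "\<beta> \<in> Wstar S"
  shows "Theta S (\<mu>, quot_word (labels S) \<alpha> \<beta>, \<nu>) = (\<mu>, int (length \<alpha>) - int (length \<beta>), \<nu>)"
  unfolding Theta_def prod.case
proof (rule the_equality)
  fix y
  assume "\<exists>\<alpha>'\<in>Wstar S. \<exists>\<beta>'\<in>Wstar S. quot_word (labels S) \<alpha> \<beta> = quot_word (labels S) \<alpha>' \<beta>'
    \<and> y = (\<mu>, int (length \<alpha>') - int (length \<beta>'), \<nu>)"
  then show "y = (\<mu>, int (length \<alpha>) - int (length \<beta>), \<nu>)"
    using word_degree_quot_word[OF Wstar_labels[OF gbds]] assms by metis
qed (use assms in blast)

lemma Theta_arrow:
  assumes "(\<mu>, t, \<nu>) \<in> transformation_arrows S"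
  shows "Theta S (\<mu>, t, \<nu>) = (\<mu>, word_degree t, \<nu>)"
  using assms Theta_quot_word word_degree_quot_word tail_equal_words
  unfolding transformation_arrows_iff by metis

lemma Theta_image: "Theta S ` transformation_arrows S = shift_arrows S"
proof (intro equalityI subsetI)
  fix y assume "y \<in> Theta S ` transformation_arrows S"
  then obtain \<mu> t \<nu> where y: "y = Theta S (\<mu>, t, \<nu>)" "(\<mu>, t, \<nu>) \<in> transformation_arrows S"
    by (metis image_iff prod_cases3)
  then obtain \<alpha> \<beta> where "t = quot_word (labels S) \<alpha> \<beta>" "tail_equal S \<alpha> \<beta> \<mu> \<nu>"
    unfolding transformation_arrows_iff by blast
  then show "y \<in> shift_arrows S"
    using y(1) Theta_quot_word tail_equal_words(1,2) by (auto simp: shift_arrows_iff)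
next
  fix y assume y: "y \<in> shift_arrows S"
  obtain \<mu> n \<nu> where "y = (\<mu>, n, \<nu>)" by (rule prod_cases3)
  then obtain \<alpha> \<beta> where *: "y = (\<mu>, int (length \<alpha>) - int (length \<beta>), \<nu>)" "tail_equal S \<alpha> \<beta> \<mu> \<nu>"
    using y shift_arrows_iff by blast
  have "y = Theta S (\<mu>, quot_word (labels S) \<alpha> \<beta>, \<nu>)"
    using * Theta_quot_word tail_equal_words(1,2) by simp
  moreover have "(\<mu>, quot_word (labels S) \<alpha> \<beta>, \<nu>) \<in> transformation_arrows S"
    using *(2) transformation_arrows_iff by blast
  ultimately show "y \<in> Theta S ` transformation_arrows S" by (rule image_eqI)
qed

text \<open>The longer words extend the shorter ones by \<gamma> and \<delta>, which have equal
  length because the differences of lengths agree. Both are initial words of the same remaining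
  path, so they coincide and cancel.\<close>

lemma quot_word_eq_if_tail_equal:
  assumes "tail_equal S \<alpha> \<beta> \<mu> \<nu>" "tail_equal S \<alpha>' \<beta>' \<mu> \<nu>" "length \<alpha> \<le> length \<alpha>'"
    and "int (length \<alpha>) - int (length \<beta>) = int (length \<alpha>') - int (length \<beta>')"
  shows "quot_word (labels S) \<alpha>' \<beta>' = quot_word (labels S) \<alpha> \<beta>"
proof -
  have *: "\<mu> \<in> boundary S" "\<nu> \<in> boundary S" "starts_with \<alpha> \<mu>" "starts_with \<alpha>' \<mu>"
    "starts_with \<beta> \<nu>" "starts_with \<beta>' \<nu>" "(shift ^^ length \<alpha>) \<mu> = (shift ^^ length \<beta>) \<nu>"
    using assms(1,2) by (simp_all add: tail_equal_def)
  obtain \<gamma> where \<gamma>: "\<alpha>' = \<alpha> @ \<gamma>" using starts_with_prefix[OF *(3,4) assms(3)] .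
  have "length \<beta> \<le> length \<beta>'" using assms(3,4) by simp
  then obtain \<delta> where \<delta>: "\<beta>' = \<beta> @ \<delta>" using starts_with_prefix[OF *(5,6)] by blast
  have "\<gamma> = \<delta>"
  proof (rule starts_with_unique)
    show "starts_with \<gamma> ((shift ^^ length \<alpha>) \<mu>)" using *(1,4) \<gamma> starts_with_append by blast
    show "starts_with \<delta> ((shift ^^ length \<alpha>) \<mu>)"
      using *(2,6,7) \<delta> starts_with_append by metis
    show "length \<gamma> = length \<delta>" using assms(4) \<gamma> \<delta> by simp
  qed
  then show ?thesis
    using quot_word_append[of \<alpha> "labels S" \<beta> \<gamma>] \<gamma> \<delta> tail_equal_words(3,4)[OF assms(1)]
      tail_equal_words(3)[OF assms(2)] by simp
qed

lemma Theta_inj: "inj_on (Theta S) (transformation_arrows S)"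
proof (rule inj_onI)
  fix x y assume x: "x \<in> transformation_arrows S" and y: "y \<in> transformation_arrows S"
    and eq: "Theta S x = Theta S y"
  obtain \<mu> t \<nu> \<mu>' t' \<nu>' where xy: "x = (\<mu>, t, \<nu>)" "y = (\<mu>', t', \<nu>')" by (metis prod_cases3)
  then have deg: "\<mu>' = \<mu>" "\<nu>' = \<nu>" "word_degree t = word_degree t'"
    using x y eq Theta_arrow by auto
  obtain \<alpha> \<beta> where t: "t = quot_word (labels S) \<alpha> \<beta>" "tail_equal S \<alpha> \<beta> \<mu> \<nu>"
    using x xy transformation_arrows_iff by blast
  obtain \<alpha>' \<beta>' where t': "t' = quot_word (labels S) \<alpha>' \<beta>'" "tail_equal S \<alpha>' \<beta>' \<mu> \<nu>"
    using y xy deg transformation_arrows_iff by blast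
  have len: "int (length \<alpha>) - int (length \<beta>) = int (length \<alpha>') - int (length \<beta>')"
    using deg(3) t t' word_degree_quot_word tail_equal_words(4) by metis
  have "t = t'"
  proof (cases "length \<alpha> \<le> length \<alpha>'")
    case True
    then show ?thesis using quot_word_eq_if_tail_equal[OF t(2) t'(2) _ len] t t' by simp
  next
    case False
    then show ?thesis using quot_word_eq_if_tail_equal[OF t'(2) t(2) _ len[symmetric]] t t' by simp
  qed
  then show "x = y" using xy deg by simp
qed

end


section \<open>Topology\<close>

lemma initial_path_E_n:
  assumes "\<mu> \<in> boundary S" "enat n \<le> path_length \<mu>" "n \<noteq> 0"
  shows "initial_path n \<mu> \<in> E_n S n"
proof (cases \<mu>)
  case (Vertex v)
  then show ?thesis using assms by (simp add: zero_enat_def)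
next
  case (Finite_Path p)
  then have p: "n \<le> length p" "set p \<subseteq> E1 S"
    "\<forall>i. Suc i < length p \<longrightarrow> dom_edge (p ! i) = rng_edge S (p ! Suc i)"
    using assms by (simp_all add: boundary_iff)
  have "initial_path n \<mu> = Finite_Path (take n p)"
    using Finite_Path p(1) by (auto simp: initial_path_def intro: nth_equalityI)
  then show ?thesis
    using assms(3) p set_take_subset[of n p] by (auto simp: E_n_def intro!: imageI)
next
  case (Infinite_Path f)
  then show ?thesis
    using assms by (auto simp: boundary_iff initial_path_def E_n_def intro!: imageI)
qed

lemma topspace_E1_top: "topspace (E1_top S) = E1 S"
  by (auto simp: E1_top_def E1_def)

lemma path_length_boundary_ge_1:
  assumes "\<mu> \<in> boundary S" "\<mu> \<noteq> Vertex (path_rng S \<mu>)"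
  shows "enat 1 \<le> path_length \<mu>"
  using assms(1)
proof (cases rule: boundary_cases)
  case (edge e \<nu>)
  have "enat 1 = eSuc 0" by (simp add: eSuc_enat zero_enat_def)
  then show ?thesis unfolding edge(1) path_length_prepend_edge by simp
qed (use assms in simp)

text \<open>The set meets only the paths of length \<open>length w\<close>, and there it is cut out
  by a finite product of components of the disjoint union \<open>E1_top S\<close>, each of which is
  open.\<close>

lemma openin_E_star_words:
  assumes "w \<noteq> []" "w \<in> lists (labels S)"
  shows "openin (E_star_top S) {\<mu> \<in> E_n S (length w). map (\<lambda>i. fst (edge \<mu> i)) [0..<length w] = w}"
    (is "openin _ ?X")
proof -
  have X: "?X \<inter> E_n S n = (if n = length w then ?X else {})" for n
    using assms(1) by (auto simp: E_n_def split: if_splits)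
  have sub: "?X \<subseteq> E_star S" by (auto simp: E_star_def)
  let ?P = "\<Pi>\<^sub>E i\<in>{..<length w}. {w ! i} \<times> ultrafilters_in (ideal S (w ! i))"
  have "openin (E1_top S) ({w ! i} \<times> ultrafilters_in (ideal S (w ! i)))" if "i < length w" for i
  proof -
    have "w ! i \<in> labels S" using assms(2) that by (metis in_listsD nth_mem)
    then have "openin (E1_top S) (Pair (w ! i) ` topspace (ultrafilter_topology (ideal S (w ! i))))"
      unfolding E1_top_def
      using open_map_component_injection[of "w ! i" "labels S" "\<lambda>a. ultrafilter_topology (ideal S a)"]
      unfolding open_map_def by blast
    moreover have "Pair (w ! i) ` ultrafilters_in (ideal S (w ! i))
        = {w ! i} \<times> ultrafilters_in (ideal S (w ! i))" by auto
    ultimately show ?thesis by (simp only: topspace_ultrafilter_topology)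
  qed
  then have P: "openin (product_topology (\<lambda>_. E1_top S) {..<length w}) ?P"
    by (simp add: openin_PiE)
  have "?X = (\<lambda>\<mu>. \<lambda>i\<in>{..<length w}. edge \<mu> i) -` ?P \<inter> E_n S (length w)"
  proof (intro equalityI subsetI)
    fix \<mu> assume \<mu>: "\<mu> \<in> ?X"
    then obtain p where p: "\<mu> = Finite_Path p" "length p = length w" "set p \<subseteq> E1 S"
      using assms(1) by (auto simp: E_n_def)
    have "p ! i \<in> {w ! i} \<times> ultrafilters_in (ideal S (w ! i))" if i: "i < length w" for i
    proof -
      have "w ! i = map (\<lambda>i. fst (edge \<mu> i)) [0..<length w] ! i" using \<mu> by simp
      then have "fst (p ! i) = w ! i" using i p(1) by simp
      moreover have "p ! i \<in> E1 S" using p i by (metis nth_mem subsetD)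
      ultimately show ?thesis by (auto simp: E1_def)
    qed
    then show "\<mu> \<in> (\<lambda>\<mu>. \<lambda>i\<in>{..<length w}. edge \<mu> i) -` ?P \<inter> E_n S (length w)"
      using \<mu> p(1) by auto
  next
    fix \<mu> assume "\<mu> \<in> (\<lambda>\<mu>. \<lambda>i\<in>{..<length w}. edge \<mu> i) -` ?P \<inter> E_n S (length w)"
    then have \<mu>: "\<mu> \<in> E_n S (length w)" "(\<lambda>i\<in>{..<length w}. edge \<mu> i) \<in> ?P" by auto
    have "fst (edge \<mu> i) = w ! i" if "i < length w" for i
      using PiE_mem[OF \<mu>(2), of i] that by auto
    then have "map (\<lambda>i. fst (edge \<mu> i)) [0..<length w] = w" by (intro nth_equalityI) auto
    then show "\<mu> \<in> ?X" using \<mu>(1) by blast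
  qed
  then have "openin (E_n_top S (length w)) ?X"
    using assms(1) P by (auto simp: E_n_top_def openin_pullback_topology)
  then show ?thesis using X sub by (simp add: openin_E_star_top)
qed

lemma openin_cylinder:
  assumes "openin (E_star_top S) U"
  shows "openin (boundary_top S) (cylinder S U)"
proof -
  have "cylinder S {} = {}" by (simp add: cylinder_def)
  then have "cylinder S U \<in> {cylinder S U - cylinder S K | U K.
      openin (E_star_top S) U \<and> compactin (E_star_top S) K}"
    using assms by (intro CollectI exI[of _ U] exI[of _ "{}"]) simp
  then show ?thesis unfolding boundary_top_def by (rule topology_generated_by_Basis)
qed

lemma openin_pullback_topology_self:
  "A \<subseteq> f -` topspace T \<Longrightarrow> openin (pullback_topology A f T) A"
  unfolding openin_pullback_topology by (intro exI[of _ "topspace T"]) auto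

lemma openin_E_n: "openin (E_n_top S n) (E_n S n)"
proof (cases "n = 0")
  case True
  have "topspace (E0_top S) = E0 S"
    unfolding E0_top_def E0_def by (rule topspace_ultrafilter_topology)
  then have "E_n S 0 \<subseteq> path_dom -` topspace (E0_top S)" by (auto simp: E_n_def)
  from openin_pullback_topology_self[OF this] show ?thesis using True by (simp add: E_n_top_def)
next
  case False
  have "E_n S n \<subseteq> (\<lambda>\<mu>. \<lambda>i\<in>{..<n}. edge \<mu> i)
      -` topspace (product_topology (\<lambda>_. E1_top S) {..<n})"
    using False nth_mem by (fastforce simp: E_n_def topspace_E1_top)
  from openin_pullback_topology_self[OF this] show ?thesis using False by (simp add: E_n_top_def)
qed

lemma topspace_boundary_top: "topspace (boundary_top S) = boundary S"
proof
  show "topspace (boundary_top S) \<subseteq> boundary S"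
    unfolding boundary_top_def topology_generated_by_topspace by (auto simp: cylinder_def)
  have "boundary S \<subseteq> cylinder S (topspace (E_star_top S))"
  proof
    fix \<mu> assume \<mu>: "\<mu> \<in> boundary S"
    have "E_star S \<inter> E_n S n = E_n S n" for n by (auto simp: E_star_def)
    then have "openin (E_star_top S) (E_star S)" by (simp add: openin_E_star_top openin_E_n)
    then have star: "E_star S \<subseteq> topspace (E_star_top S)" by (rule openin_subset)
    show "\<mu> \<in> cylinder S (topspace (E_star_top S))"
    \<comment> \<open>This equation singles out the vertices. A longer path may have range
      \<open>{}\<close>, which is not in \<open>E0 S\<close>, so it is caught by its first edge
      instead of its range.\<close>
    proof (cases "\<mu> = Vertex (path_rng S \<mu>)")
      case True
      then have "path_rng S \<mu> \<in> E0 S" using \<mu> boundary_iff(1)[of "path_rng S \<mu>" S] by (simp add: E0_sg_def)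
      then have "Vertex (path_rng S \<mu>) \<in> E_n S 0" by (simp add: E_n_def)
      then have "Vertex (path_rng S \<mu>) \<in> E_star S" unfolding E_star_def by blast
      then show ?thesis using \<mu> star unfolding cylinder_def by blast
    next
      case False
      then have len: "enat 1 \<le> path_length \<mu>" using path_length_boundary_ge_1[OF \<mu>] by blast
      then have "initial_path 1 \<mu> \<in> E_star S"
        using initial_path_E_n[OF \<mu> len] by (auto simp: E_star_def)
      then show ?thesis using \<mu> star len unfolding cylinder_def by blast
    qed
  qed
  moreover have "openin (boundary_top S) (cylinder S (topspace (E_star_top S)))"
    by (rule openin_cylinder) simp
  ultimately show "boundary S \<subseteq> topspace (boundary_top S)" using openin_subset by blast
qed

lemma openin_starts_with:
  assumes "w \<in> lists (labels S)"
  shows "openin (boundary_top S) {\<mu> \<in> boundary S. starts_with w \<mu>}"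
proof (cases "w = []")
  case True
  then show ?thesis using openin_topspace[of "boundary_top S"] by (simp add: topspace_boundary_top)
next
  case False
  let ?X = "{\<mu> \<in> E_n S (length w). map (\<lambda>i. fst (edge \<mu> i)) [0..<length w] = w}"
  have "{\<mu> \<in> boundary S. starts_with w \<mu>} = cylinder S ?X"
  proof (intro equalityI subsetI)
    fix \<mu> assume "\<mu> \<in> {\<mu> \<in> boundary S. starts_with w \<mu>}"
    then have \<mu>: "\<mu> \<in> boundary S" "enat (length w) \<le> path_length \<mu>"
      "map (\<lambda>i. fst (edge \<mu> i)) [0..<length w] = w" by (auto simp: starts_with_def)
    have "map (\<lambda>i. fst (edge (initial_path (length w) \<mu>) i)) [0..<length w]
        = map (\<lambda>i. fst (edge \<mu> i)) [0..<length w]"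
      by (simp add: initial_path_def)
    then have "initial_path (length w) \<mu> \<in> ?X"
      using initial_path_E_n[OF \<mu>(1,2)] False \<mu>(3) by simp
    moreover have "length w \<ge> 1" using False by (cases w) auto
    ultimately show "\<mu> \<in> cylinder S ?X" using \<mu>(1,2) unfolding cylinder_def by blast
  next
    fix \<mu> assume "\<mu> \<in> cylinder S ?X"
    moreover have "Vertex v \<notin> ?X" for v using False by (auto simp: E_n_def)
    ultimately obtain i where i: "\<mu> \<in> boundary S" "enat i \<le> path_length \<mu>" "initial_path i \<mu> \<in> ?X"
      unfolding cylinder_def by blast
    then have len: "i = length w" using False by (auto simp: initial_path_def E_n_def)
    have "map (\<lambda>i. fst (edge (initial_path (length w) \<mu>) i)) [0..<length w]
        = map (\<lambda>i. fst (edge \<mu> i)) [0..<length w]"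
      by (simp add: initial_path_def)
    from trans[OF this[symmetric]] show "\<mu> \<in> {\<mu> \<in> boundary S. starts_with w \<mu>}"
      using i unfolding len starts_with_def by blast
  qed
  then show ?thesis using openin_cylinder[OF openin_E_star_words[OF False assms]] by simp
qed


section \<open>The groupoid isomorphism\<close>

text \<open>Every composable pair of \<open>H\<close> is the image of one of \<open>G\<close>, so
  axioms and continuity pass to \<open>H\<close> by conjugating with \<open>f\<close> and its
  inverse. This gives the continuity of the operations of the shift groupoid without handling its
  topology directly.\<close>

lemma topological_groupoid_iso_transport:
  fixes G :: "('g, 'm) top_groupoid_scheme" and H :: "('h, 'n) top_groupoid_scheme"
  assumes G: "topological_groupoid G"
    and f: "homeomorphic_map (gtop G) (gtop H) f"
    and top: "topspace (gtop H) = arrows H"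
    and composable: "composable H = (\<lambda>(g, h). (f g, f h)) ` composable G"
    and mult: "\<And>g h. (g, h) \<in> composable G \<Longrightarrow> gmult H (f g) (f h) = f (gmult G g h)"
    and inv: "\<And>g. g \<in> arrows G \<Longrightarrow> ginv H (f g) = f (ginv G g)"
  shows "topological_groupoid_iso G H f"
proof -
  have gpd: "groupoid G" and topG: "topspace (gtop G) = arrows G"
    and cmult: "continuous_map (subtopology (prod_topology (gtop G) (gtop G)) (composable G)) (gtop G)
       (\<lambda>(g, h). gmult G g h)"
    and cinv: "continuous_map (gtop G) (gtop G) (ginv G)"
    using G by (simp_all add: topological_groupoid_def)
  have comp_sub: "composable G \<subseteq> arrows G \<times> arrows G"
    and mult_in: "(g, h) \<in> composable G \<Longrightarrow> gmult G g h \<in> arrows G"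
    and inv_in: "g \<in> arrows G \<Longrightarrow> ginv G g \<in> arrows G \<and> ginv G (ginv G g) = g \<and> (ginv G g, g) \<in> composable G"
    and assoc: "(g, h) \<in> composable G \<Longrightarrow> (h, k) \<in> composable G \<Longrightarrow>
        (gmult G g h, k) \<in> composable G \<and> (g, gmult G h k) \<in> composable G
        \<and> gmult G (gmult G g h) k = gmult G g (gmult G h k)"
    and cancel: "(g, h) \<in> composable G \<Longrightarrow> gmult G (ginv G g) (gmult G g h) = h
        \<and> gmult G (gmult G g h) (ginv G h) = g" for g h k
    using gpd unfolding groupoid_def by blast+
  obtain f' where f': "homeomorphic_maps (gtop G) (gtop H) f f'"
    using f homeomorphic_map_maps by blast
  then have cf: "continuous_map (gtop G) (gtop H) f" and cf': "continuous_map (gtop H) (gtop G) f'"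
    and f'f: "\<And>g. g \<in> arrows G \<Longrightarrow> f' (f g) = g"
    and ff': "\<And>x. x \<in> arrows H \<Longrightarrow> f (f' x) = x"
    by (simp_all add: homeomorphic_maps_def top topG)
  have f_in: "f g \<in> arrows H" if "g \<in> arrows G" for g
    using cf that top topG by (auto simp: continuous_map_def)
  have f'_in: "f' x \<in> arrows G" if "x \<in> arrows H" for x
    using cf' that top topG by (auto simp: continuous_map_def)
  \<comment> \<open>The image of \<open>composable G\<close> reflects composability because the
    inverse \<open>f'\<close> makes \<open>f\<close> injective on arrows.\<close>
  have comp_iff: "(f g, f h) \<in> composable H \<longleftrightarrow> (g, h) \<in> composable G"
    if "g \<in> arrows G" "h \<in> arrows G" for g h
  proof
    assume "(f g, f h) \<in> composable H"
    then obtain g' h' where gh': "(g', h') \<in> composable G" "f g = f g'" "f h = f h'"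
      unfolding composable by auto
    then have "g' \<in> arrows G" "h' \<in> arrows G" using comp_sub by auto
    then have "g = g'" "h = h'" using gh' f'f that by metis+
    then show "(g, h) \<in> composable G" using gh' by simp
  next
    assume "(g, h) \<in> composable G"
    then show "(f g, f h) \<in> composable H" unfolding composable by force
  qed
  have compE: thesis
    if "(x, y) \<in> composable H" and
      "\<And>g h. (g, h) \<in> composable G \<Longrightarrow> x = f g \<Longrightarrow> y = f h \<Longrightarrow> g \<in> arrows G \<Longrightarrow> h \<in> arrows G \<Longrightarrow> thesis"
    for x y thesis
    using that comp_sub unfolding composable by auto
  have arrE: thesis if "x \<in> arrows H" "\<And>g. g \<in> arrows G \<Longrightarrow> x = f g \<Longrightarrow> thesis" for x thesis
    using that f'_in ff' by metis
  have comp': "(f' x, f' y) \<in> composable G" if "(x, y) \<in> composable H" for x y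
    using that by (elim compE) (simp add: f'f)
  have comp_subH: "composable H \<subseteq> arrows H \<times> arrows H"
    using f_in by (auto elim!: compE)
  have multH: "gmult H x y = f (gmult G (f' x) (f' y))" if "(x, y) \<in> composable H" for x y
    using that by (elim compE) (simp add: f'f mult)
  have "groupoid H"
    unfolding groupoid_def
  proof (intro conjI)
    show "composable H \<subseteq> arrows H \<times> arrows H" by (rule comp_subH)
    show "\<forall>(x, y)\<in>composable H. gmult H x y \<in> arrows H"
      by (auto elim!: compE simp: mult mult_in f_in)
    show "\<forall>x\<in>arrows H. ginv H x \<in> arrows H \<and> ginv H (ginv H x) = x \<and> (ginv H x, x) \<in> composable H"
      by (auto elim!: arrE simp: inv inv_in f_in comp_iff)
    show "\<forall>x y z. (x, y) \<in> composable H \<longrightarrow> (y, z) \<in> composable H \<longrightarrow>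
        (gmult H x y, z) \<in> composable H \<and> (x, gmult H y z) \<in> composable H
        \<and> gmult H (gmult H x y) z = gmult H x (gmult H y z)"
    proof (intro allI impI)
      fix x y z assume xy: "(x, y) \<in> composable H" and yz: "(y, z) \<in> composable H"
      then obtain g h k where x: "x = f g" "y = f h" "z = f k"
        and arr: "g \<in> arrows G" "h \<in> arrows G" "k \<in> arrows G"
        using arrE comp_subH by (metis mem_Sigma_iff subsetD)
      then have gh: "(g, h) \<in> composable G" "(h, k) \<in> composable G" using xy yz comp_iff by blast+
      show "(gmult H x y, z) \<in> composable H \<and> (x, gmult H y z) \<in> composable H
        \<and> gmult H (gmult H x y) z = gmult H x (gmult H y z)"
        using assoc[OF gh] gh arr unfolding x by (simp add: mult comp_iff mult_in)
    qed
    show "\<forall>(x, y)\<in>composable H. gmult H (ginv H x) (gmult H x y) = y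
        \<and> gmult H (gmult H x y) (ginv H y) = x"
    proof (intro ballI, clarify)
      fix x y assume "(x, y) \<in> composable H"
      then obtain g h where x: "x = f g" "y = f h" and gh: "(g, h) \<in> composable G"
        and arr: "g \<in> arrows G" "h \<in> arrows G" by (rule compE)
      have "(ginv G g, gmult G g h) \<in> composable G" "(gmult G g h, ginv G h) \<in> composable G"
        using assoc[OF _ gh] assoc[OF gh] inv_in arr by metis+
      then show "gmult H (ginv H x) (gmult H x y) = y \<and> gmult H (gmult H x y) (ginv H y) = x"
        using cancel[OF gh] gh arr unfolding x by (simp add: mult inv)
    qed
  qed
  moreover have "continuous_map (subtopology (prod_topology (gtop H) (gtop H)) (composable H)) (gtop H)
       (\<lambda>(x, y). gmult H x y)"
  proof -
    \<comment> \<open>On composable pairs the product of \<open>H\<close> is \<open>f\<close> after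
      the product of \<open>G\<close> after \<open>f'\<close> in both factors.\<close>
    let ?XH = "subtopology (prod_topology (gtop H) (gtop H)) (composable H)"
    have "continuous_map ?XH (prod_topology (gtop G) (gtop G)) (\<lambda>p. (f' (fst p), f' (snd p)))"
      using continuous_map_compose[OF continuous_map_fst cf', of "gtop H"]
        continuous_map_compose[OF continuous_map_snd cf', of "gtop H"]
      by (intro continuous_map_from_subtopology continuous_map_pairedI) (simp_all add: o_def)
    then have "continuous_map ?XH (subtopology (prod_topology (gtop G) (gtop G)) (composable G))
        (\<lambda>p. (f' (fst p), f' (snd p)))"
      by (rule continuous_map_into_subtopology) (auto intro: comp')
    from continuous_map_compose[OF continuous_map_compose[OF this cmult] cf]
    show ?thesis
      by (rule continuous_map_eq) (auto simp: multH)
  qed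
  moreover have "continuous_map (gtop H) (gtop H) (ginv H)"
    using continuous_map_compose[OF continuous_map_compose[OF cf' cinv] cf]
    by (rule continuous_map_eq) (metis comp_apply f'_in ff' inv top)
  ultimately have "topological_groupoid H" by (simp add: topological_groupoid_def top)
  moreover have "groupoid_hom G H f"
    using comp_sub by (auto simp: groupoid_hom_def f_in comp_iff mult)
  moreover have "groupoid_hom H G f'"
    using comp_sub by (auto simp: groupoid_hom_def f'_in f'f mult mult_in elim!: compE)
  ultimately show ?thesis using G f' unfolding topological_groupoid_iso_def by blast
qed

section \<open>The transformation groupoid as a topological groupoid\<close>

context
  fixes S :: "('l, 'b::generalized_boolean_algebra) gbds"
  assumes gbds: "generalized_boolean_dynamical_system S"
begin

lemma transformation_arrows_sub:
  "transformation_arrows S \<subseteq> boundary S \<times> carrier (free_group (labels S)) \<times> boundary S"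
  by (auto simp: transformation_arrows_def)

lemma topspace_transformation_groupoid:
  "topspace (gtop (transformation_groupoid S)) = transformation_arrows S"
  using transformation_arrows_sub
  by (simp add: transformation_groupoid_def topspace_boundary_top Int_absorb1)

lemma groupoid_transformation_groupoid: "groupoid (transformation_groupoid S)"
proof -
  interpret group "free_group (labels S)" by (rule group_free_group)
  have carr: "t \<in> carrier (free_group (labels S))" if "(\<mu>, t, \<nu>) \<in> transformation_arrows S" for \<mu> t \<nu>
    using that transformation_arrows_sub by blast
  have cancel: "inv\<^bsub>free_group (labels S)\<^esub> t \<otimes>\<^bsub>free_group (labels S)\<^esub> (t \<otimes>\<^bsub>free_group (labels S)\<^esub> s) = s"
    "t \<otimes>\<^bsub>free_group (labels S)\<^esub> s \<otimes>\<^bsub>free_group (labels S)\<^esub> inv\<^bsub>free_group (labels S)\<^esub> s = t"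
    if "t \<in> carrier (free_group (labels S))" "s \<in> carrier (free_group (labels S))" for t s
    using that by (simp flip: m_assoc) (simp add: that m_assoc)
  show ?thesis
    unfolding groupoid_def
    using transformation_arrows_mult[OF gbds] transformation_arrows_inv[OF gbds]
    by (auto simp: transformation_groupoid_def carr cancel m_assoc)
qed

lemma continuous_map_into_transformation_groupoid:
  assumes "continuous_map X (boundary_top S) a"
    and "continuous_map X (discrete_topology (carrier (free_group (labels S)))) b"
    and "continuous_map X (boundary_top S) c"
    and "\<And>x. x \<in> topspace X \<Longrightarrow> (a x, b x, c x) \<in> transformation_arrows S"
  shows "continuous_map X (gtop (transformation_groupoid S)) (\<lambda>x. (a x, b x, c x))"
  using assms
  by (auto simp: transformation_groupoid_def continuous_map_in_subtopology continuous_map_paired)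

lemma topological_groupoid_transformation_groupoid:
  "topological_groupoid (transformation_groupoid S)"
proof -
  interpret group "free_group (labels S)" by (rule group_free_group)
  let ?F = "free_group (labels S)"
  let ?G = "transformation_groupoid S"
  let ?B = "boundary_top S" and ?D = "discrete_topology (carrier ?F)"
  let ?X = "subtopology (prod_topology (gtop ?G) (gtop ?G)) (composable ?G)"
  have proj: "continuous_map (gtop ?G) ?B fst" "continuous_map (gtop ?G) ?D (fst \<circ> snd)"
    "continuous_map (gtop ?G) ?B (snd \<circ> snd)"
    unfolding transformation_groupoid_def top_groupoid.simps
    by (rule continuous_map_from_subtopology[OF continuous_map_fst],
      rule continuous_map_from_subtopology[OF continuous_map_compose[OF continuous_map_snd continuous_map_fst]],
      rule continuous_map_from_subtopology[OF continuous_map_compose[OF continuous_map_snd continuous_map_snd]])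
  have left: "continuous_map ?X (gtop ?G) fst" and right: "continuous_map ?X (gtop ?G) snd"
    by (rule continuous_map_from_subtopology[OF continuous_map_fst],
      rule continuous_map_from_subtopology[OF continuous_map_snd])
  \<comment> \<open>A product of discrete topologies is discrete, so every map on it into the group
    is continuous once it takes values there.\<close>
  have op: "continuous_map (prod_topology ?D ?D) ?D (\<lambda>(t, s). t \<otimes>\<^bsub>?F\<^esub> s)"
    unfolding prod_topology_discrete_topology[symmetric] by auto
  have "continuous_map ?X (prod_topology ?D ?D) (\<lambda>p. (fst (snd (fst p)), fst (snd (snd p))))"
    using continuous_map_compose[OF left proj(2)] continuous_map_compose[OF right proj(2)]
    by (intro continuous_map_pairedI) (simp_all add: o_def)
  from continuous_map_compose[OF this op]
  have mid: "continuous_map ?X ?D (\<lambda>p. fst (snd (fst p)) \<otimes>\<^bsub>?F\<^esub> fst (snd (snd p)))"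
    by (simp add: o_def)
  have "continuous_map ?X (gtop ?G)
      (\<lambda>p. (fst (fst p), fst (snd (fst p)) \<otimes>\<^bsub>?F\<^esub> fst (snd (snd p)), snd (snd (snd p))))"
  proof (rule continuous_map_into_transformation_groupoid[OF _ mid])
    show "continuous_map ?X ?B (\<lambda>p. fst (fst p))" "continuous_map ?X ?B (\<lambda>p. snd (snd (snd p)))"
      using continuous_map_compose[OF left proj(1)] continuous_map_compose[OF right proj(3)]
      by (simp_all add: o_def)
  next
    fix p assume "p \<in> topspace ?X"
    then have "p \<in> composable ?G" by simp
    then show "(fst (fst p), fst (snd (fst p)) \<otimes>\<^bsub>?F\<^esub> fst (snd (snd p)), snd (snd (snd p)))
        \<in> transformation_arrows S"
      using transformation_arrows_mult[OF gbds] by (auto simp: transformation_groupoid_def)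
  qed
  then have "continuous_map ?X (gtop ?G) (\<lambda>(g, h). gmult ?G g h)"
    by (rule continuous_map_eq) (auto simp: transformation_groupoid_def split: prod.splits)
  moreover have "continuous_map (gtop ?G) (gtop ?G) (ginv ?G)"
  proof -
    have "continuous_map (gtop ?G) ?D (\<lambda>g. inv\<^bsub>?F\<^esub> (fst (snd g)))"
      using continuous_map_compose[OF proj(2), of ?D "m_inv ?F"] by (simp add: o_def)
    then have "continuous_map (gtop ?G) (gtop ?G) (\<lambda>g. (snd (snd g), inv\<^bsub>?F\<^esub> (fst (snd g)), fst g))"
      using proj transformation_arrows_inv[OF gbds]
      by (intro continuous_map_into_transformation_groupoid)
        (auto simp: o_def topspace_transformation_groupoid)
    then show ?thesis
      by (rule continuous_map_eq) (auto simp: transformation_groupoid_def)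
  qed
  moreover have "arrows ?G = transformation_arrows S" by (simp add: transformation_groupoid_def)
  ultimately show ?thesis
    using groupoid_transformation_groupoid topspace_transformation_groupoid
    by (simp add: topological_groupoid_def)
qed

section \<open>Basic open sets and the homeomorphism \<open>Theta\<close>\<close>

definition tail_box :: "('l, 'b) bpath set \<Rightarrow> ('l, 'b) bpath set \<Rightarrow> nat \<Rightarrow> nat
    \<Rightarrow> (('l, 'b) bpath \<times> int \<times> ('l, 'b) bpath) set" where
  "tail_box U V k l = {(\<mu>, int k - int l, \<nu>) | \<mu> \<nu>. \<mu> \<in> U \<and> \<nu> \<in> V \<and> (shift ^^ k) \<mu> = (shift ^^ l) \<nu>}"

definition shift_basis :: "(('l, 'b) bpath \<times> int \<times> ('l, 'b) bpath) set set" where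
  "shift_basis = {tail_box U V k l | U V k l.
      openin (boundary_top S) U \<and> U \<subseteq> shift_domain S k \<and> inj_on (shift ^^ k) U
    \<and> openin (boundary_top S) V \<and> V \<subseteq> shift_domain S l \<and> inj_on (shift ^^ l) V}"

lemma gtop_shift_groupoid: "gtop (shift_groupoid S) = topology_generated_by shift_basis"
  by (simp add: shift_groupoid_def shift_basis_def tail_box_def)

text \<open>Cutting an open set down to the paths that start with a word keeps it open and makes the
  corresponding power of the shift defined and injective on it. This supplies basic sets around any
  given arrow.\<close>

lemma tail_box_shift_basis:
  assumes "openin (boundary_top S) U" "openin (boundary_top S) V"
    and "\<alpha> \<in> lists (labels S)" "\<beta> \<in> lists (labels S)"
  shows "tail_box {\<mu> \<in> U. starts_with \<alpha> \<mu>} {\<nu> \<in> V. starts_with \<beta> \<nu>} (length \<alpha>) (length \<beta>) \<in> shift_basis"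
proof -
  have *: "openin (boundary_top S) {\<mu> \<in> U. starts_with w \<mu>}
      \<and> {\<mu> \<in> U. starts_with w \<mu>} \<subseteq> shift_domain S (length w)
      \<and> inj_on (shift ^^ length w) {\<mu> \<in> U. starts_with w \<mu>}"
    if U: "openin (boundary_top S) U" and w: "w \<in> lists (labels S)" for U w
  proof (intro conjI)
    have sub: "U \<subseteq> boundary S" using openin_subset[OF U] by (simp add: topspace_boundary_top)
    then have "{\<mu> \<in> U. starts_with w \<mu>} = U \<inter> {\<mu> \<in> boundary S. starts_with w \<mu>}" by blast
    then show "openin (boundary_top S) {\<mu> \<in> U. starts_with w \<mu>}"
      using U openin_starts_with[OF w] by (simp add: openin_Int)
    show "{\<mu> \<in> U. starts_with w \<mu>} \<subseteq> shift_domain S (length w)"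
      using sub unfolding shift_domain_eq by blast
    show "inj_on (shift ^^ length w) {\<mu> \<in> U. starts_with w \<mu>}"
      using sub shift_inj_starts_with[OF gbds, of _ _ w] by (intro inj_onI) blast
  qed
  show ?thesis
    unfolding shift_basis_def using *[OF assms(1,3)] *[OF assms(2,4)] by blast
qed

lemma Union_shift_basis: "\<Union>shift_basis = shift_arrows S"
proof
  show "\<Union>shift_basis \<subseteq> shift_arrows S"
    unfolding shift_basis_def tail_box_def shift_arrows_def by blast
  show "shift_arrows S \<subseteq> \<Union>shift_basis"
  proof
    fix y assume y: "y \<in> shift_arrows S"
    obtain \<mu> n \<nu> where "y = (\<mu>, n, \<nu>)" by (rule prod_cases3)
    then obtain \<alpha> \<beta> where *: "y = (\<mu>, int (length \<alpha>) - int (length \<beta>), \<nu>)" "tail_equal S \<alpha> \<beta> \<mu> \<nu>"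
      using y shift_arrows_iff[OF gbds] by blast
    have "openin (boundary_top S) (boundary S)"
      using openin_topspace[of "boundary_top S"] by (simp add: topspace_boundary_top)
    from tail_box_shift_basis[OF this this tail_equal_words(3,4)[OF gbds *(2)]]
    show "y \<in> \<Union>shift_basis"
      using * by (intro UnionI) (auto simp: tail_box_def tail_equal_def)
  qed
qed

lemma topspace_shift_groupoid: "topspace (gtop (shift_groupoid S)) = shift_arrows S"
  unfolding gtop_shift_groupoid topology_generated_by_topspace by (rule Union_shift_basis)

text \<open>Since the group is discrete, \<open>{t}\<close> is open and neighbourhoods may be taken
  with the middle coordinate fixed.\<close>

lemma openin_transformation_groupoidI:
  assumes "W \<subseteq> transformation_arrows S"
    and "\<And>\<mu> t \<nu>. (\<mu>, t, \<nu>) \<in> W \<Longrightarrow> \<exists>U V. openin (boundary_top S) U \<and> openin (boundary_top S) V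
      \<and> \<mu> \<in> U \<and> \<nu> \<in> V \<and> (\<forall>\<mu>'\<in>U. \<forall>\<nu>'\<in>V. (\<mu>', t, \<nu>') \<in> transformation_arrows S \<longrightarrow> (\<mu>', t, \<nu>') \<in> W)"
  shows "openin (gtop (transformation_groupoid S)) W"
proof (subst openin_subopen, intro ballI)
  fix x assume x: "x \<in> W"
  obtain \<mu> t \<nu> where xeq: "x = (\<mu>, t, \<nu>)" by (rule prod_cases3)
  have "(\<mu>, t, \<nu>) \<in> W" using x xeq by simp
  from assms(2)[OF this] obtain U V where UV: "openin (boundary_top S) U" "openin (boundary_top S) V"
    "\<mu> \<in> U" "\<nu> \<in> V"
    "\<forall>\<mu>'\<in>U. \<forall>\<nu>'\<in>V. (\<mu>', t, \<nu>') \<in> transformation_arrows S \<longrightarrow> (\<mu>', t, \<nu>') \<in> W"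
    by (elim exE conjE)
  have arr: "(\<mu>, t, \<nu>) \<in> transformation_arrows S" using x xeq assms(1) by blast
  then have t: "t \<in> carrier (free_group (labels S))" using transformation_arrows_sub by blast
  have "openin (gtop (transformation_groupoid S)) ((U \<times> {t} \<times> V) \<inter> transformation_arrows S)"
    unfolding transformation_groupoid_def top_groupoid.simps
    using UV(1,2) t by (intro openin_subtopology_Int) (simp add: openin_prod_Times_iff)
  then show "\<exists>T. openin (gtop (transformation_groupoid S)) T \<and> x \<in> T \<and> T \<subseteq> W"
    using UV arr xeq by (intro exI[of _ "(U \<times> {t} \<times> V) \<inter> transformation_arrows S"]) auto
qed

text \<open>A basic set prescribes the powers \<open>k\<close> and \<open>l\<close>, while an arrow
  prescribes a group element. Near the given arrow the first \<open>k\<close> labels on the left and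
  the first \<open>l\<close> on the right are constant, and \<open>tail_equal_quot_word\<close>
  yields the equation between the shifts for all nearby arrows with the same
  \<open>t\<close>.\<close>

lemma continuous_map_Theta:
  "continuous_map (gtop (transformation_groupoid S)) (gtop (shift_groupoid S)) (Theta S)"
  unfolding gtop_shift_groupoid
proof (rule continuous_on_generated_topo)
  show "Theta S ` topspace (gtop (transformation_groupoid S)) \<subseteq> \<Union>shift_basis"
    by (simp add: topspace_transformation_groupoid Union_shift_basis Theta_image[OF gbds])
next
  fix Z assume "Z \<in> shift_basis"
  then obtain U V k l where Z: "Z = tail_box U V k l"
    and U: "openin (boundary_top S) U" "U \<subseteq> shift_domain S k"
    and V: "openin (boundary_top S) V" "V \<subseteq> shift_domain S l"
    unfolding shift_basis_def by blast
  show "openin (gtop (transformation_groupoid S))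
      (Theta S -` Z \<inter> topspace (gtop (transformation_groupoid S)))"
    unfolding topspace_transformation_groupoid
  proof (rule openin_transformation_groupoidI)
    fix \<mu> t \<nu> assume "(\<mu>, t, \<nu>) \<in> Theta S -` Z \<inter> transformation_arrows S"
    then have arr: "(\<mu>, t, \<nu>) \<in> transformation_arrows S" and inZ: "(\<mu>, word_degree t, \<nu>) \<in> Z"
      using Theta_arrow[OF gbds] by auto
    then have \<mu>\<nu>: "\<mu> \<in> U" "\<nu> \<in> V" "(shift ^^ k) \<mu> = (shift ^^ l) \<nu>" and deg: "word_degree t = int k - int l"
      by (auto simp: Z tail_box_def)
    obtain \<alpha> where \<alpha>: "length \<alpha> = k" "starts_with \<alpha> \<mu>" "\<mu> \<in> boundary S"
      using \<mu>\<nu>(1) U(2) unfolding shift_domain_eq by blast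
    obtain \<beta> where \<beta>: "length \<beta> = l" "starts_with \<beta> \<nu>" "\<nu> \<in> boundary S"
      using \<mu>\<nu>(2) V(2) unfolding shift_domain_eq by blast
    have teq: "tail_equal S \<alpha> \<beta> \<mu> \<nu>" using \<alpha> \<beta> \<mu>\<nu>(3) by (simp add: tail_equal_def)
    note words = tail_equal_words[OF gbds teq]
    \<comment> \<open>Both \<open>t\<close> and the quotient of the words of lengths
      \<open>k\<close> and \<open>l\<close> give arrows with the same image, so injectivity of
      \<open>Theta\<close> identifies them. The pair of words may be far from reduced.\<close>
    have "(\<mu>, quot_word (labels S) \<alpha> \<beta>, \<nu>) \<in> transformation_arrows S"
      using teq transformation_arrows_iff[OF gbds] by blast
    moreover have "Theta S (\<mu>, quot_word (labels S) \<alpha> \<beta>, \<nu>) = Theta S (\<mu>, t, \<nu>)"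
      using Theta_quot_word[OF gbds words(1,2)] Theta_arrow[OF gbds arr] deg \<alpha>(1) \<beta>(1) by simp
    ultimately have t: "t = quot_word (labels S) \<alpha> \<beta>"
      using inj_onD[OF Theta_inj[OF gbds] _ _ arr] by fastforce
    let ?U = "U \<inter> {\<mu> \<in> boundary S. starts_with \<alpha> \<mu>}" and ?V = "V \<inter> {\<nu> \<in> boundary S. starts_with \<beta> \<nu>}"
    have "openin (boundary_top S) ?U" "openin (boundary_top S) ?V"
      by (rule openin_Int[OF U(1) openin_starts_with[OF words(3)]],
        rule openin_Int[OF V(1) openin_starts_with[OF words(4)]])
    moreover have "(\<mu>', t, \<nu>') \<in> Theta S -` Z \<inter> transformation_arrows S"
      if "\<mu>' \<in> ?U" "\<nu>' \<in> ?V" and arr': "(\<mu>', t, \<nu>') \<in> transformation_arrows S" for \<mu>' \<nu>'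
    proof -
      have "tail_equal S \<alpha> \<beta> \<mu>' \<nu>'"
        using tail_equal_quot_word[OF gbds] that unfolding t by blast
      then have "(\<mu>', word_degree t, \<nu>') \<in> Z"
        using that \<alpha>(1) \<beta>(1) unfolding deg Z tail_box_def tail_equal_def by blast
      then show ?thesis using arr' Theta_arrow[OF gbds arr'] by simp
    qed
    ultimately show "\<exists>U V. openin (boundary_top S) U \<and> openin (boundary_top S) V
      \<and> \<mu> \<in> U \<and> \<nu> \<in> V \<and> (\<forall>\<mu>'\<in>U. \<forall>\<nu>'\<in>V. (\<mu>', t, \<nu>') \<in> transformation_arrows S \<longrightarrow>
          (\<mu>', t, \<nu>') \<in> Theta S -` Z \<inter> transformation_arrows S)"
      using \<mu>\<nu>(1,2) \<alpha>(2,3) \<beta>(2,3) by (intro exI[of _ ?U] exI[of _ ?V]) blast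
  qed blast
qed

text \<open>The words that represent \<open>t\<close> also cut out the basic set around the image.
  Tail equality along these fixed words means that every element of that set is the image of an
  arrow over the same \<open>t\<close>, which the product neighbourhood then places in
  \<open>W\<close>.\<close>

lemma open_map_Theta:
  "open_map (gtop (transformation_groupoid S)) (gtop (shift_groupoid S)) (Theta S)"
  unfolding open_map_def
proof (intro allI impI)
  fix W assume W: "openin (gtop (transformation_groupoid S)) W"
  then obtain W' where W': "W = W' \<inter> transformation_arrows S" and op: "openin (prod_topology (boundary_top S)
      (prod_topology (discrete_topology (carrier (free_group (labels S)))) (boundary_top S))) W'"
    by (auto simp: transformation_groupoid_def openin_subtopology)
  show "openin (gtop (shift_groupoid S)) (Theta S ` W)"
  proof (subst openin_subopen, intro ballI)
    fix y assume "y \<in> Theta S ` W"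
    then obtain x where x: "x \<in> W" "y = Theta S x" by blast
    obtain \<mu> t \<nu> where xeq: "x = (\<mu>, t, \<nu>)" by (rule prod_cases3)
    then have arr: "(\<mu>, t, \<nu>) \<in> transformation_arrows S" "(\<mu>, t, \<nu>) \<in> W'" using x W' by auto
    obtain U Y where UY: "openin (boundary_top S) U" "\<mu> \<in> U" "(t, \<nu>) \<in> Y" "U \<times> Y \<subseteq> W'"
      "openin (prod_topology (discrete_topology (carrier (free_group (labels S)))) (boundary_top S)) Y"
      using op arr(2) unfolding openin_prod_topology_alt[of "boundary_top S"] by metis
    obtain V T where V: "openin (boundary_top S) V" "\<nu> \<in> V" "t \<in> T" "T \<times> V \<subseteq> Y"
      using UY(3,5) unfolding openin_prod_topology_alt by metis
    obtain \<alpha> \<beta> where t: "t = quot_word (labels S) \<alpha> \<beta>" "tail_equal S \<alpha> \<beta> \<mu> \<nu>"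
      using arr(1) transformation_arrows_iff[OF gbds] by blast
    note words = tail_equal_words[OF gbds t(2)]
    let ?Z = "tail_box {\<mu> \<in> U. starts_with \<alpha> \<mu>} {\<nu> \<in> V. starts_with \<beta> \<nu>} (length \<alpha>) (length \<beta>)"
    have "openin (gtop (shift_groupoid S)) ?Z"
      unfolding gtop_shift_groupoid
      by (rule topology_generated_by_Basis[OF tail_box_shift_basis[OF UY(1) V(1) words(3,4)]])
    moreover have "y = (\<mu>, int (length \<alpha>) - int (length \<beta>), \<nu>)"
      using x(2) xeq t(1) Theta_quot_word[OF gbds words(1,2)] by simp
    then have "y \<in> ?Z" using t(2) UY(2) V(2) by (auto simp: tail_box_def tail_equal_def)
    moreover have "?Z \<subseteq> Theta S ` W"
    proof
      fix z assume "z \<in> ?Z"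
      then obtain \<mu>' \<nu>' where z: "z = (\<mu>', int (length \<alpha>) - int (length \<beta>), \<nu>')" "\<mu>' \<in> U" "\<nu>' \<in> V"
        "starts_with \<alpha> \<mu>'" "starts_with \<beta> \<nu>'" "(shift ^^ length \<alpha>) \<mu>' = (shift ^^ length \<beta>) \<nu>'"
        unfolding tail_box_def by blast
      moreover have "\<mu>' \<in> boundary S" "\<nu>' \<in> boundary S"
        using z(2,3) openin_subset[OF UY(1)] openin_subset[OF V(1)] by (auto simp: topspace_boundary_top)
      ultimately have "tail_equal S \<alpha> \<beta> \<mu>' \<nu>'" by (simp add: tail_equal_def)
      then have "(\<mu>', t, \<nu>') \<in> transformation_arrows S"
        using t(1) transformation_arrows_iff[OF gbds] by blast
      moreover have "(\<mu>', t, \<nu>') \<in> W'" using z(2,3) V(3,4) UY(4) by blast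
      ultimately have "(\<mu>', t, \<nu>') \<in> W" using W' by blast
      moreover have "z = Theta S (\<mu>', t, \<nu>')"
        using z(1) t(1) Theta_quot_word[OF gbds words(1,2)] by simp
      ultimately show "z \<in> Theta S ` W" by blast
    qed
    ultimately show "\<exists>T. openin (gtop (shift_groupoid S)) T \<and> y \<in> T \<and> T \<subseteq> Theta S ` W" by blast
  qed
qed

lemma homeomorphic_map_Theta:
  "homeomorphic_map (gtop (transformation_groupoid S)) (gtop (shift_groupoid S)) (Theta S)"
  by (rule bijective_open_imp_homeomorphic_map[OF continuous_map_Theta open_map_Theta])
    (simp_all add: topspace_transformation_groupoid topspace_shift_groupoid
      Theta_image[OF gbds] Theta_inj[OF gbds])

lemma topological_groupoid_iso_Theta:
  "topological_groupoid_iso (transformation_groupoid S) (shift_groupoid S) (Theta S)"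
proof (rule topological_groupoid_iso_transport[OF topological_groupoid_transformation_groupoid
      homeomorphic_map_Theta])
  have Theta_in: "(\<mu>, word_degree t, \<nu>) \<in> shift_arrows S" if "(\<mu>, t, \<nu>) \<in> transformation_arrows S" for \<mu> t \<nu>
    using Theta_image[OF gbds] Theta_arrow[OF gbds that] that by (metis imageI)
  have Theta_lift: "\<exists>t. (\<mu>, t, \<nu>) \<in> transformation_arrows S \<and> n = word_degree t"
    if "(\<mu>, n, \<nu>) \<in> shift_arrows S" for \<mu> n \<nu>
  proof -
    have "(\<mu>, n, \<nu>) \<in> Theta S ` transformation_arrows S"
      unfolding Theta_image[OF gbds] by (rule that)
    then obtain x where x: "x \<in> transformation_arrows S" "(\<mu>, n, \<nu>) = Theta S x" by blast
    obtain \<mu>' t \<nu>' where "x = (\<mu>', t, \<nu>')" by (rule prod_cases3)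
    then show ?thesis using x Theta_arrow[OF gbds] by auto
  qed
  show "topspace (gtop (shift_groupoid S)) = arrows (shift_groupoid S)"
    unfolding topspace_shift_groupoid by (simp add: shift_groupoid_def)
  show "composable (shift_groupoid S)
      = (\<lambda>(g, h). (Theta S g, Theta S h)) ` composable (transformation_groupoid S)"
  proof (intro equalityI subsetI)
    fix p assume "p \<in> composable (shift_groupoid S)"
    then obtain \<mu> n \<nu> m \<delta> where p: "p = ((\<mu>, n, \<nu>), (\<nu>, m, \<delta>))"
      "(\<mu>, n, \<nu>) \<in> shift_arrows S" "(\<nu>, m, \<delta>) \<in> shift_arrows S"
      by (auto simp: shift_groupoid_def)
    \<comment> \<open>\<open>Theta\<close> keeps the outer coordinates, so the two lifted arrows
      still share \<nu> and are composable.\<close>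
    obtain t s where ts: "(\<mu>, t, \<nu>) \<in> transformation_arrows S" "n = word_degree t"
      "(\<nu>, s, \<delta>) \<in> transformation_arrows S" "m = word_degree s"
      using Theta_lift p(2,3) by meson
    then have "((\<mu>, t, \<nu>), (\<nu>, s, \<delta>)) \<in> composable (transformation_groupoid S)"
      by (simp add: transformation_groupoid_def)
    moreover have "p = (Theta S (\<mu>, t, \<nu>), Theta S (\<nu>, s, \<delta>))"
      using p(1) ts Theta_arrow[OF gbds] by simp
    ultimately show "p \<in> (\<lambda>(g, h). (Theta S g, Theta S h)) ` composable (transformation_groupoid S)"
      by (intro image_eqI) auto
  next
    fix p assume "p \<in> (\<lambda>(g, h). (Theta S g, Theta S h)) ` composable (transformation_groupoid S)"
    then show "p \<in> composable (shift_groupoid S)"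
      using Theta_arrow[OF gbds] Theta_in by (auto simp: shift_groupoid_def transformation_groupoid_def)
  qed
  show "gmult (shift_groupoid S) (Theta S g) (Theta S h) = Theta S (gmult (transformation_groupoid S) g h)"
    if "(g, h) \<in> composable (transformation_groupoid S)" for g h
    using that Theta_arrow[OF gbds] transformation_arrows_mult[OF gbds] word_degree_mult[of "labels S"]
    by (auto simp: shift_groupoid_def transformation_groupoid_def)
  show "ginv (shift_groupoid S) (Theta S g) = Theta S (ginv (transformation_groupoid S) g)"
    if g: "g \<in> arrows (transformation_groupoid S)" for g
  proof -
    obtain \<mu> t \<nu> where geq: "g = (\<mu>, t, \<nu>)" by (rule prod_cases3)
    then have arr: "(\<mu>, t, \<nu>) \<in> transformation_arrows S" using g by (simp add: transformation_groupoid_def)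
    then have "t \<in> carrier (free_group (labels S))" using transformation_arrows_sub by blast
    then show ?thesis
      using geq Theta_arrow[OF gbds arr] Theta_arrow[OF gbds transformation_arrows_inv[OF gbds arr]]
      by (simp add: shift_groupoid_def transformation_groupoid_def word_degree_inv)
  qed
qed

end

theorem theorem4p4:
  fixes S :: "('l, 'b::generalized_boolean_algebra) gbds"
  assumes "generalized_boolean_dynamical_system S"
  shows "(\<forall>(\<mu>, t, \<nu>) \<in> arrows (transformation_groupoid S).
            \<exists>\<alpha>\<in>Wstar S. \<exists>\<beta>\<in>Wstar S. t = quot_word (labels S) \<alpha> \<beta>)
       \<and> (\<forall>\<mu> \<nu>. \<forall>\<alpha>\<in>Wstar S. \<forall>\<beta>\<in>Wstar S.
            (\<mu>, quot_word (labels S) \<alpha> \<beta>, \<nu>) \<in> arrows (transformation_groupoid S) \<longrightarrow>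
            Theta S (\<mu>, quot_word (labels S) \<alpha> \<beta>, \<nu>) = (\<mu>, int (length \<alpha>) - int (length \<beta>), \<nu>))
       \<and> topological_groupoid_iso (transformation_groupoid S) (shift_groupoid S) (Theta S)"
proof (intro conjI)
  have "\<exists>\<alpha>\<in>Wstar S. \<exists>\<beta>\<in>Wstar S. t = quot_word (labels S) \<alpha> \<beta>"
    if arr: "(\<mu>, t, \<nu>) \<in> transformation_arrows S" for \<mu> t \<nu>
  proof -
    obtain \<alpha> \<beta> where "t = quot_word (labels S) \<alpha> \<beta>" "tail_equal S \<alpha> \<beta> \<mu> \<nu>"
      using arr by (rule transformation_arrowE[OF assms])
    then show ?thesis using tail_equal_words(1,2)[OF assms] by blast
  qed
  then show "\<forall>(\<mu>, t, \<nu>) \<in> arrows (transformation_groupoid S).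
      \<exists>\<alpha>\<in>Wstar S. \<exists>\<beta>\<in>Wstar S. t = quot_word (labels S) \<alpha> \<beta>"
    by (auto simp: transformation_groupoid_def)
qed (use Theta_quot_word[OF assms] topological_groupoid_iso_Theta[OF assms] in blast)+

end
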